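(* Let $\mathbf{A}\in\mathbb{R}^{kn\times d}$ have $n$ blocks $\mathbf{A}_1,\dots,\mathbf{A}_n\in\mathbb{R}^{k\times d}$, let $\mathbf{Q}\in\mathbb{R}^{d\times d}$ with $\mathbf{Q}\succeq\mathbf{0}$, and let $\epsilon\in(0,1)$, $\delta\in(0,1)$. Let $\{\tau_i^{\mathbf{Q}}(\mathbf{A})\}_{i=1}^n$ be the block partial leverage scores and let $\{\hat\tau_i^{\mathbf{Q}}(\mathbf{A})\}_{i=1}^n$ be overestimates, i.e. $\hat\tau_i^{\mathbf{Q}}(\mathbf{A})\ge\tau_i^{\mathbf{Q}}(\mathbf{A})$ for $i=1,\dots,n$. Let $p_i=\hat\tau_i^{\mathbf{Q}}(\mathbf{A})/\sum_{j=1}^n\hat\tau_j^{\mathbf{Q}}(\mathbf{A})$. Construct $\mathbf{S}\mathbf{A}$ by (independently for each $i$) sampling the $i$-th block of $\mathbf{A}$ with probability $q_i=\min\{s\cdot p_i,1\}$ and rescaling it by $1/\sqrt{q_i}$. If $$s\ge 4\Big(\sum_{i=1}^n\hat\tau_i^{\mathbf{Q}}(\mathbf{A})\Big)\cdot\log\frac{4d}{\delta}\cdot\frac1{\epsilon^2},$$ then with probability at least $1-\delta$, $$-\epsilon(\mathbf{A}^T\mathbf{A}+\mathbf{Q})\preceq(\mathbf{A}^T\mathbf{S}^T\mathbf{S}\mathbf{A}+\mathbf{Q})-(\mathbf{A}^T\mathbf{A}+\mathbf{Q})\preceq\epsilon(\mathbf{A}^T\mathbf{A}+\mathbf{Q}),$$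 and thus, writing $\mathbf{H}=\mathbf{A}^T\mathbf{A}+\mathbf{Q}$ and $\widetilde{\mathbf{H}}=\mathbf{A}^T\mathbf{S}^T\mathbf{S}\mathbf{A}+\mathbf{Q}$, for every cone $\mathcal{K}\subseteq\mathbb{R}^d$ one has $|\mathbf{x}^T(\widetilde{\mathbf{H}}-\mathbf{H})\mathbf{y}|\le\epsilon\sqrt{\mathbf{x}^T\mathbf{H}\mathbf{x}}\sqrt{\mathbf{y}^T\mathbf{H}\mathbf{y}}$ for all $\mathbf{x},\mathbf{y}\in\mathcal{K}$.
   Context: The leverage scores of a matrix $\mathbf{B}$ with rows $\mathbf{b}_j^T$ are $\tau_j(\mathbf{B})=\mathbf{b}_j^T(\mathbf{B}^T\mathbf{B})^\dagger\mathbf{b}_j$. For $\mathbf{A}=(\mathbf{A}_1^T,\dots,\mathbf{A}_n^T)^T\in\mathbb{R}^{kn\times d}$ with blocks of $k$ rows and $\mathbf{Q}\succeq\mathbf{0}$, let $\tau_1,\dots,\tau_{kn+d}$ be the leverage scores of $\begin{pmatrix}\mathbf{A}\\ \mathbf{Q}^{1/2}\end{pmatrix}$; the block partial leverage score of the $i$-th block is $\tau_i^{\mathbf{Q}}(\mathbf{A})=\sum_{j=k(i-1)+1}^{ki}\tau_j$. Sampling the blocks means that $\mathbf{A}^T\mathbf{S}^T\mathbf{S}\mathbf{A}=\sum_{i=1}^n\frac{\xi_i}{q_i}\mathbf{A}_i^T\mathbf{A}_i$, where $\xi_i$ are independent Bernoulli variables with $P(\xi_i=1)=q_i$ (blocks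 with $q_i=0$ are dropped). The order $\preceq$ is the Loewner (positive semidefinite) order. *)

theory Defs
  imports "HOL-Probability.Probability"
begin

definition psd :: "real^'m^'m \<Rightarrow> bool" where
  "psd M \<longleftrightarrow> transpose M = M \<and> (\<forall>x. 0 \<le> x \<bullet> (M *v x))"

definition loewner_le :: "real^'m^'m \<Rightarrow> real^'m^'m \<Rightarrow> bool"  (infix "\<preceq>\<^sub>L" 50) where
  "M \<preceq>\<^sub>L N \<longleftrightarrow> psd (N - M)"

definition psd_sqrt :: "real^'m^'m \<Rightarrow> real^'m^'m" where
  "psd_sqrt Q = (THE R. psd R \<and> R ** R = Q)"

text \<open>The Moore--Penrose pseudoinverse, given by the four Penrose conditions.\<close>

definition is_pinv :: "real^'n^'m \<Rightarrow> real^'m^'n \<Rightarrow> bool" where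
  "is_pinv M X \<longleftrightarrow> M ** X ** M = M \<and> X ** M ** X = X \<and>
     transpose (M ** X) = M ** X \<and> transpose (X ** M) = X ** M"

definition pinv :: "real^'n^'m \<Rightarrow> real^'m^'n" where
  "pinv M = (THE X. is_pinv M X)"

definition leverage_score :: "real^'d^'r \<Rightarrow> 'r \<Rightarrow> real" where
  "leverage_score B j = row j B \<bullet> (pinv (transpose B ** B) *v row j B)"

definition vstack :: "real^'d^'r \<Rightarrow> real^'d^'s \<Rightarrow> real^'d^('r + 's)" where
  "vstack B C = (\<chi> j. case j of Inl a \<Rightarrow> B $ a | Inr b \<Rightarrow> C $ b)"

text \<open>
  A matrix with \<open>n\<close> blocks of \<open>k\<close> rows has its rows indexed by \<open>'n \<times> 'k\<close>:
  the pair \<open>(i, j)\<close> is the \<open>j\<close>-th row of the \<open>i\<close>-th block.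
\<close>

definition block :: "real^'d^('n::finite \<times> 'k::finite) \<Rightarrow> 'n \<Rightarrow> real^'d^'k" where
  "block A i = (\<chi> j. A $ (i, j))"

definition block_partial_leverage_score ::
  "real^'d^'d \<Rightarrow> real^'d^('n::finite \<times> 'k::finite) \<Rightarrow> 'n \<Rightarrow> real" where
  "block_partial_leverage_score Q A i =
     (\<Sum>j\<in>UNIV. leverage_score (vstack A (psd_sqrt Q)) (Inl (i, j)))"

text \<open>
  Each row of block \<open>i\<close> is multiplied by \<open>1 / sqrt (q i)\<close> if the block is sampled
  (\<open>\<xi> i\<close>), and by \<open>0\<close> otherwise.  Dropped blocks are thus kept as zero rows, which does
  not affect the Gram matrix of the sampled matrix; see \<open>sampling_matrix_gram\<close>.  If
  \<open>q i = 0\<close> the block is always dropped, since \<open>1 / sqrt 0 = 0\<close>.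
\<close>

definition sampling_matrix ::
  "('n \<Rightarrow> real) \<Rightarrow> ('n \<Rightarrow> bool) \<Rightarrow> real^('n::finite \<times> 'k::finite)^('n \<times> 'k)" where
  "sampling_matrix q \<xi> =
     (\<chi> r c. if r = c then of_bool (\<xi> (fst r)) * (1 / sqrt (q (fst r))) else 0)"

lemma sampling_matrix_mult:
  fixes A :: "real^'d^('n::finite \<times> 'k::finite)"
  shows "(sampling_matrix q \<xi> ** A) $ r $ l =
         of_bool (\<xi> (fst r)) * (1 / sqrt (q (fst r))) * A $ r $ l"
  by (simp add: matrix_matrix_mult_def sampling_matrix_def if_distrib [of "\<lambda>x. x * _"]
      cong: if_cong)

lemma gram_nth:
  fixes B :: "real^'d^'r"
  shows "(transpose B ** B) $ a $ b = (\<Sum>r\<in>UNIV. B $ r $ a * B $ r $ b)"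
  by (simp add: matrix_matrix_mult_def transpose_def)

lemma sampling_matrix_gram:
  fixes A :: "real^'d^('n::finite \<times> 'k::finite)"
  assumes "\<And>i. 0 \<le> q i"
  shows "transpose A ** transpose (sampling_matrix q \<xi>) ** sampling_matrix q \<xi> ** A =
         (\<Sum>i\<in>UNIV. (of_bool (\<xi> i) / q i) *\<^sub>R (transpose (block A i) ** block A i))"
proof -
  let ?S = "sampling_matrix q \<xi> :: real^('n \<times> 'k)^('n \<times> 'k)"
  have "transpose A ** transpose ?S ** ?S ** A = transpose (?S ** A) ** (?S ** A)"
    by (simp add: matrix_transpose_mul matrix_mul_assoc)
  also have "\<dots> = (\<Sum>i\<in>UNIV. (of_bool (\<xi> i) / q i) *\<^sub>R (transpose (block A i) ** block A i))"
  proof -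
    have "(transpose (?S ** A) ** (?S ** A)) $ a $ b =
          (\<Sum>i\<in>UNIV. (of_bool (\<xi> i) / q i) *\<^sub>R (transpose (block A i) ** block A i)) $ a $ b" for a b
    proof -
      have "(transpose (?S ** A) ** (?S ** A)) $ a $ b =
            (\<Sum>r\<in>UNIV. (?S ** A) $ r $ a * (?S ** A) $ r $ b)"
        by (rule gram_nth)
      also have "\<dots> = (\<Sum>r\<in>UNIV. (of_bool (\<xi> (fst r)) / q (fst r)) * (A $ r $ a * A $ r $ b))"
      proof (rule sum.cong [OF refl])
        fix r :: "'n \<times> 'k"
        have "sqrt (q (fst r)) * sqrt (q (fst r)) = q (fst r)"
          using assms by simp
        then show "(?S ** A) $ r $ a * (?S ** A) $ r $ b =
              (of_bool (\<xi> (fst r)) / q (fst r)) * (A $ r $ a * A $ r $ b)"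
          by (simp add: sampling_matrix_mult)
      qed
      also have "\<dots> = (\<Sum>i\<in>UNIV. \<Sum>j\<in>UNIV. (of_bool (\<xi> i) / q i) * (A $ (i,j) $ a * A $ (i,j) $ b))"
        by (simp add: sum.cartesian_product UNIV_Times_UNIV [symmetric] case_prod_beta
            del: UNIV_Times_UNIV)
      also have "\<dots> = (\<Sum>i\<in>UNIV. (of_bool (\<xi> i) / q i) *\<^sub>R (transpose (block A i) ** block A i)) $ a $ b"
        by (simp add: gram_nth block_def sum_distrib_left)
      finally show ?thesis .
    qed
    then show ?thesis
      by (simp add: vec_eq_iff)
  qed
  finally show ?thesis .
qed

end

theory Submission
  imports Defs
begin

text \<open>
  Whitening by a square root of \<open>H\<^sup>+\<close> turns the claim into a two-sided spectral bound for
  \<open>\<Sum>i. X i\<close> with \<open>X i = (\<xi> i / q i - 1) L i\<close>, where the \<open>L i\<close> are positive semidefinite, sum to at most the identity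
  and have the block partial leverage scores as traces. The upper tail of the largest eigenvalue is
  controlled by the exponential moment of the trace. Bounding it with the full variance
  \<open>\<parallel>\<Sum>i. E (X i)\<^sup>2\<parallel>\<close>, rather than with \<open>\<Sum>i. \<parallel>E (X i)\<^sup>2\<parallel>\<close>, usually needs Lieb's theorem; here the
  Golden--Thompson inequality suffices, because the variance of each summand is subtracted inside the
  exponential before the summand is averaged out.
\<close>

text \<open>Golden--Thompson admits only two matrices, so one random summand is split off at a time,
  leaving the average of its exponential next to the exponential of the rest. A norm bound on that
  average would add up norms of variances. Compensation makes the average at most the identity in
  the Loewner order, so it drops out of the trace; the compensators are deterministic and are paid
  for once, at the end, where they add up as matrices. If trace L i is at most q i R whenever q i <
  1, and the L i sum to at most I, their total is at most theta^2 R I. The resulting exponent theta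
  eps - theta^2 R with R = eps^2 / (4 l) has maximum l, at theta = 2 l / eps; this is the origin of
  the 4 in the condition on s. The two tails together cost 2 d exp(-l), which for l = log(4 d /
  delta) is delta / 2.\<close>

lemma matrix_mult_simps:
  fixes A B :: "real^'n^'m" and C D :: "real^'p^'n"
  shows "(A + B) ** C = A ** C + B ** C"
    and "(A - B) ** C = A ** C - B ** C"
    and "A ** (C + D) = A ** C + A ** D"
    and "A ** (C - D) = A ** C - A ** D"
    and "(c *\<^sub>R A) ** C = c *\<^sub>R (A ** C)"
    and "A ** (c *\<^sub>R C) = c *\<^sub>R (A ** C)"
    and "0 ** C = (0 :: real^'p^'m)"
    and "A ** 0 = (0 :: real^'p^'m)"
  by (simp_all add: vec_eq_iff matrix_matrix_mult_def sum.distrib sum_subtractf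
      sum_distrib_left algebra_simps)

lemma matrix_mult_sum_simps:
  fixes A :: "real^'n^'m" and F :: "'i \<Rightarrow> real^'p^'n"
    and G :: "'i \<Rightarrow> real^'n^'m" and C :: "real^'p^'n"
  shows "A ** sum F I = (\<Sum>i\<in>I. A ** F i)"
    and "sum G I ** C = (\<Sum>i\<in>I. G i ** C)"
  by (induction I rule: infinite_finite_induct; simp add: matrix_mult_simps)+

lemma transpose_simps:
  fixes A B :: "real^'n^'m"
  shows "transpose (A + B) = transpose A + transpose B"
    and "transpose (A - B) = transpose A - transpose B"
    and "transpose (c *\<^sub>R A) = c *\<^sub>R transpose A"
    and "transpose (0 :: real^'n^'m) = 0"
  by (simp_all add: vec_eq_iff transpose_def)

lemma transpose_sum: "transpose (sum F I) = (\<Sum>i\<in>I. transpose (F i :: real^'n^'m))"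
  by (induction I rule: infinite_finite_induct) (simp_all add: transpose_simps)

lemma trace_simps:
  fixes A :: "real^'n^'n"
  shows "trace (c *\<^sub>R A) = c * trace A"
    and "trace (sum F I) = (\<Sum>i\<in>I. trace (F i :: real^'n^'n))"
proof -
  show "trace (sum F I) = (\<Sum>i\<in>I. trace (F i :: real^'n^'n))"
    by (induction I rule: infinite_finite_induct) (simp_all add: trace_add, simp_all add: trace_def)
qed (simp add: trace_def sum_distrib_left)

lemma trace_transpose_mult: "trace (transpose A ** B) = A \<bullet> (B :: real^'n^'m)"
  unfolding trace_def inner_vec_def matrix_matrix_mult_def transpose_def
  by (simp, subst sum.swap) simp

lemma inner_matrix_vector_transpose:
  fixes A :: "real^'n^'m"
  shows "x \<bullet> (A *v y) = (transpose A *v x) \<bullet> y"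
  by (simp add: dot_lmul_matrix flip: vector_transpose_matrix)

lemma sum_matrix_vector_mult:
  fixes F :: "'i \<Rightarrow> real^'n^'m"
  shows "sum F I *v x = (\<Sum>i\<in>I. F i *v x)"
  by (induction I rule: infinite_finite_induct) (simp_all add: matrix_vector_mult_add_rdistrib)

lemma scaleR_matrix_vector_mult:
  fixes A :: "real^'n^'m"
  shows "(c *\<^sub>R A) *v x = c *\<^sub>R (A *v x)"
  by (simp add: vec_eq_iff matrix_vector_mult_def sum_distrib_left mult.assoc)

subsection \<open>The spectral theorem\<close>

text \<open>A maximiser of the Rayleigh quotient on the compact unit sphere of the subspace is an
  eigenvector: a nonzero residual would be a direction in which the quotient still grows.\<close>

lemma self_adjoint_eigenvector_in_subspace:
  fixes f :: "'a::euclidean_space \<Rightarrow> 'a"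
  assumes f: "linear f" and adj: "\<And>x y. f x \<bullet> y = x \<bullet> f y"
    and S: "subspace S" "f ` S \<subseteq> S" "dim S \<noteq> 0"
  obtains e c where "e \<in> S" "norm e = 1" "f e = c *\<^sub>R e"
proof -
  let ?K = "S \<inter> sphere 0 1"
  have "compact ?K"
    using closed_subspace[OF S(1)] by (simp add: closed_Int_compact)
  moreover obtain z where z: "z \<in> S" "z \<noteq> 0"
    using S(3) by (metis dim_eq_0 singleton_iff subsetI)
  then have "(1 / norm z) *\<^sub>R z \<in> ?K"
    by (simp add: S(1) subspace_scale)
  moreover have "continuous_on ?K (\<lambda>x. x \<bullet> f x)"
    by (intro continuous_intros linear_continuous_on) (simp add: f linear_conv_bounded_linear[symmetric])
  ultimately obtain e where e: "e \<in> ?K" and max: "\<And>x. x \<in> ?K \<Longrightarrow> x \<bullet> f x \<le> e \<bullet> f e"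
    using continuous_attains_sup[of ?K "\<lambda>x. x \<bullet> f x"] by blast
  define c where "c = e \<bullet> f e"
  have ee: "e \<bullet> e = 1" "e \<in> S" "norm e = 1"
    using e by (auto simp: dot_square_norm)
  have pos: "x \<bullet> f x \<le> c * (x \<bullet> x)" if "x \<in> S" for x
  proof (cases "x = 0")
    case True
    then show ?thesis by simp
  next
    case False
    have "(1 / norm x) *\<^sub>R x \<in> ?K"
      using that False by (simp add: S(1) subspace_scale)
    from max[OF this] have "(x \<bullet> f x) / (norm x)\<^sup>2 \<le> c"
      by (simp add: linear_scale[OF f] c_def power2_eq_square)
    then show ?thesis
      using False by (simp add: divide_le_eq dot_square_norm)
  qed
  define r where "r = f e - c *\<^sub>R e"
  have rS: "r \<in> S"
    unfolding r_def using S ee by (auto intro!: subspace_diff subspace_scale)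
  have "r = 0"
  proof (rule ccontr)
    assume "r \<noteq> 0"
    define n where "n = r \<bullet> r"
    define b where "b = c * (r \<bullet> r) - r \<bullet> f r"
    have n: "n > 0" using \<open>r \<noteq> 0\<close> by (simp add: n_def)
    \<comment> \<open>the nonnegative form \<open>c\<bar>x\<bar>\<^sup>2 - x \<bullet> f x\<close> vanishes at \<open>e\<close>, so its derivative there does too\<close>
    have key: "2 * t * n \<le> t\<^sup>2 * b" for t
    proof -
      have "e + t *\<^sub>R r \<in> S" using ee rS S by (auto intro!: subspace_add subspace_scale)
      from pos[OF this]
      have "c + 2 * t * (r \<bullet> f e) + t\<^sup>2 * (r \<bullet> f r) \<le> c * (1 + 2 * t * (r \<bullet> e) + t\<^sup>2 * (r \<bullet> r))"
        using adj[of e r] ee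
        by (simp add: linear_add[OF f] linear_scale[OF f] inner_add inner_commute c_def
            power2_eq_square algebra_simps)
      moreover have "r \<bullet> f e = n + c * (r \<bullet> e)"
        by (simp add: n_def inner_diff_right r_def)
      ultimately show ?thesis by (simp add: b_def algebra_simps)
    qed
    have "b > 0" using key[of 1] n by auto
    \<comment> \<open>\<open>t = n / b\<close> minimises \<open>t\<^sup>2 * b - 2 * t * n\<close>,
      so it violates \<open>key\<close> most clearly.\<close>
    have "2 * (n / b) * n \<le> (n / b)\<^sup>2 * b" by (rule key)
    then have "2 * n\<^sup>2 \<le> n\<^sup>2" using \<open>b > 0\<close> by (simp add: power2_eq_square field_simps)
    then show False using n by simp
  qed
  then show ?thesis using that[of e c] ee by (simp add: r_def)
qed

text \<open>Self-adjointness keeps the orthogonal complement of an eigenvector invariant, so the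
  dimension can be lowered by one. An arbitrary invariant subspace \<open>S\<close> is what this
  induction needs.\<close>

lemma self_adjoint_orthonormal_eigenbasis:
  fixes f :: "'a::euclidean_space \<Rightarrow> 'a"
  assumes f: "linear f" and adj: "\<And>x y. f x \<bullet> y = x \<bullet> f y"
    and S: "subspace S" "f ` S \<subseteq> S" "dim S = n"
  shows "\<exists>B. B \<subseteq> S \<and> finite B \<and> card B = n \<and> pairwise orthogonal B \<and>
    (\<forall>b\<in>B. norm b = 1 \<and> (\<exists>c. f b = c *\<^sub>R b))"
  using S
proof (induction n arbitrary: S)
  case 0
  then show ?case by (intro exI[of _ "{}"]) auto
next
  case (Suc n)
  then obtain e c where e: "e \<in> S" "norm e = 1" "f e = c *\<^sub>R e"
    using self_adjoint_eigenvector_in_subspace[OF f adj] by (metis nat.distinct(1))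
  define T where "T = {x \<in> S. orthogonal e x}"
  have T: "subspace T"
    unfolding T_def using Suc.prems(1)
    by (auto simp: subspace_def orthogonal_def inner_add_right)
  have "dim {y \<in> S. \<forall>x\<in>span {e}. orthogonal x y} + dim (span {e}) = dim S"
    by (rule dim_subspace_orthogonal_to_vectors)
      (use Suc.prems(1) e in \<open>auto simp: span_minimal\<close>)
  moreover have "{y \<in> S. \<forall>x\<in>span {e}. orthogonal x y} = T"
    by (auto simp: T_def orthogonal_def span_breakdown_eq span_singleton)
  moreover have "dim (span {e}) = 1"
    using e by (auto simp: dim_singleton)
  ultimately have "dim T = n" using Suc.prems by simp
  moreover have "f ` T \<subseteq> T"
  proof
    fix y assume "y \<in> f ` T"
    then obtain x where x: "x \<in> T" "y = f x" by auto
    then show "y \<in> T" using Suc.prems(2) e adj[of e x]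
      by (auto simp: T_def orthogonal_def)
  qed
  ultimately obtain B where B: "B \<subseteq> T" "finite B" "card B = n" "pairwise orthogonal B"
    "\<forall>b\<in>B. norm b = 1 \<and> (\<exists>c. f b = c *\<^sub>R b)"
    using Suc.IH[OF T] by blast
  have "e \<notin> B" using B e by (auto simp: T_def orthogonal_def dot_square_norm)
  then show ?case
    using B e by (intro exI[of _ "insert e B"])
      (auto simp: T_def pairwise_insert, auto simp: orthogonal_def inner_commute)
qed

definition diag_mat :: "('n \<Rightarrow> real) \<Rightarrow> real^'n^'n" where
  "diag_mat f = (\<chi> i j. if i = j then f i else 0)"

text \<open>The rows of \<open>U\<close> are eigenvectors and \<open>f\<close> lists the
  eigenvalues. With \<open>U\<close> explicit, matrices sharing an eigenbasis are added and
  multiplied pointwise in \<open>f\<close>.\<close>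

definition spec :: "real^'n^'n \<Rightarrow> ('n \<Rightarrow> real) \<Rightarrow> real^'n^'n" where
  "spec U f = transpose U ** diag_mat f ** U"

theorem spectral_theorem:
  fixes M :: "real^'n^'n"
  assumes "transpose M = M"
  obtains U f where "orthogonal_matrix U" "M = spec U f"
proof -
  have "\<exists>B. B \<subseteq> (UNIV :: (real^'n) set) \<and> finite B \<and> card B = DIM(real^'n) \<and>
      pairwise orthogonal B \<and> (\<forall>b\<in>B. norm b = 1 \<and> (\<exists>c. M *v b = c *\<^sub>R b))"
    by (rule self_adjoint_orthonormal_eigenbasis)
      (auto simp: inner_matrix_vector_transpose assms)
  then obtain B :: "(real^'n) set" where B: "finite B" "card B = CARD('n)"
    "pairwise orthogonal B" "\<And>b. b \<in> B \<Longrightarrow> norm b = 1" "\<And>b. b \<in> B \<Longrightarrow> \<exists>c. M *v b = c *\<^sub>R b"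
    by auto
  obtain h where h: "bij_betw h (UNIV :: 'n set) B"
    using finite_same_card_bij[of "UNIV :: 'n set" B] B(1,2) by auto
  define U :: "real^'n^'n" where "U = (\<chi> i. h i)"
  have hB: "h i \<in> B" for i using h by (auto simp: bij_betw_def)
  obtain c where c: "\<And>i. M *v h i = c i *\<^sub>R h i"
    using B(5)[OF hB] by metis
  have "orthogonal (h i) (h j)" if "i \<noteq> j" for i j
    using B(3) hB h that by (simp add: pairwise_def bij_betw_def inj_on_def) blast
  then have U: "orthogonal_matrix U"
    using B(4) hB by (auto simp: orthogonal_matrix_orthonormal_rows U_def row_def)
  have "M ** transpose U = transpose U ** diag_mat c"
  proof -
    have "(M *v h i) $ a = c i * h i $ a" for i a by (simp add: c)
    then show ?thesis
      by (simp add: vec_eq_iff matrix_matrix_mult_def matrix_vector_mult_def transpose_def U_def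
          diag_mat_def if_distrib[of "\<lambda>x. _ * x"] mult.commute cong: if_cong)
  qed
  then have "M = spec U c"
    using U by (metis spec_def orthogonal_matrix_def matrix_mul_assoc matrix_mul_rid)
  with U show ?thesis by (rule that)
qed

subsection \<open>Functional calculus and positive semidefinite matrices\<close>

lemma inner_congruence:
  fixes G :: "real^'m^'n"
  shows "x \<bullet> ((transpose G ** M ** G) *v x) = (G *v x) \<bullet> (M *v (G *v x))"
proof -
  have "x \<bullet> (transpose G *v (M *v (G *v x))) = (G *v x) \<bullet> (M *v (G *v x))"
    by (subst inner_matrix_vector_transpose) (simp only: transpose_transpose)
  then show ?thesis by (simp only: matrix_vector_mul_assoc matrix_mul_assoc)
qed

lemma spec_nth: "spec U f $ a $ b = (\<Sum>i\<in>UNIV. f i * (U $ i $ a * U $ i $ b))"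
  by (simp add: spec_def diag_mat_def matrix_matrix_mult_def transpose_def
      if_distrib[of "\<lambda>x. _ * x"] if_distrib[of "\<lambda>x. x * _"] ac_simps cong: if_cong)

lemma spec_linear:
  shows "spec U f + spec U g = spec U (\<lambda>i. f i + g i)"
    and "spec U f - spec U g = spec U (\<lambda>i. f i - g i)"
    and "c *\<^sub>R spec U f = spec U (\<lambda>i. c * f i)"
  by (simp_all add: vec_eq_iff spec_nth sum.distrib sum_subtractf sum_distrib_left algebra_simps)

lemma transpose_spec [simp]: "transpose (spec U f) = spec U f"
  by (simp add: vec_eq_iff spec_nth transpose_def mult.commute)

lemma inner_spec: "x \<bullet> (spec U f *v x) = (\<Sum>i\<in>UNIV. f i * ((U *v x) $ i)\<^sup>2)"
proof -
  have "x \<bullet> (spec U f *v x) = (U *v x) \<bullet> (diag_mat f *v (U *v x))"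
    by (simp only: spec_def inner_congruence)
  also have "diag_mat f *v y = (\<chi> i. f i * y $ i)" for y
    by (simp add: vec_eq_iff diag_mat_def matrix_vector_mult_def if_distrib[of "\<lambda>x. x * _"] cong: if_cong)
  finally show ?thesis by (simp add: inner_vec_def power2_eq_square ac_simps)
qed

context
  fixes U :: "real^'n^'n"
  assumes U: "orthogonal_matrix U"
begin

lemma spec_mult: "spec U f ** spec U g = spec U (\<lambda>i. f i * g i)"
proof -
  have "spec U f ** spec U g = transpose U ** diag_mat f ** (U ** transpose U) ** diag_mat g ** U"
    by (simp add: spec_def matrix_mul_assoc)
  also have "\<dots> = transpose U ** (diag_mat f ** diag_mat g) ** U"
    using U by (simp add: orthogonal_matrix_def matrix_mul_assoc)
  also have "diag_mat f ** diag_mat g = diag_mat (\<lambda>i. f i * g i)"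
    by (simp add: vec_eq_iff diag_mat_def matrix_matrix_mult_def
      if_distrib[of "\<lambda>x. _ * x"] if_distrib[of "\<lambda>x. x * _"] cong: if_cong)
  finally show ?thesis by (simp add: spec_def)
qed

lemma spec_one: "spec U (\<lambda>_. 1) = mat 1"
proof -
  have "diag_mat (\<lambda>_::'n. 1) = mat 1" by (simp add: vec_eq_iff diag_mat_def mat_def)
  then show ?thesis using U by (simp add: spec_def orthogonal_matrix_def)
qed

lemma trace_spec: "trace (spec U f) = sum f UNIV"
proof -
  have "trace (spec U f) = trace (diag_mat f ** (U ** transpose U))"
    by (metis spec_def matrix_mul_assoc trace_mul_sym)
  then show ?thesis
    using U by (simp add: orthogonal_matrix_def) (simp add: trace_def diag_mat_def)
qed

lemma sum_square_orthogonal: "(\<Sum>i\<in>UNIV. ((U *v x) $ i)\<^sup>2) = x \<bullet> x"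
  using inner_spec[of x U "\<lambda>_. 1"] by (simp add: spec_one)

lemma psd_spec_iff: "psd (spec U f) \<longleftrightarrow> (\<forall>i. 0 \<le> f i)"
proof
  assume "\<forall>i. 0 \<le> f i"
  then show "psd (spec U f)" by (auto simp: psd_def inner_spec intro: sum_nonneg)
next
  assume psd: "psd (spec U f)"
  have "0 \<le> f i" for i
  proof -
    \<comment> \<open>The \<open>i\<close>-th row of \<open>U\<close>, taken as test vector,
      isolates the eigenvalue \<open>f i\<close>.\<close>
    have "U *v (transpose U *v axis i 1) = axis i 1"
      using U by (simp add: matrix_vector_mul_assoc orthogonal_matrix_def del: transpose_matrix_vector)
    then have "(transpose U *v axis i 1) \<bullet> (spec U f *v (transpose U *v axis i 1)) = f i"
      by (simp only: inner_spec) (simp add: axis_def if_distrib[of "\<lambda>x. x^2"] if_distrib[of "\<lambda>x. _ * x"] cong: if_cong)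
    then show ?thesis using psd by (metis psd_def)
  qed
  then show "\<forall>i. 0 \<le> f i" by simp
qed

end

section \<open>Positive semidefinite matrices, square roots and the pseudoinverse\<close>

lemma psd_symmetric: "psd M \<Longrightarrow> transpose M = M"
  by (simp add: psd_def)

lemma psd_congruence:
  fixes G :: "real^'m^'n"
  shows "psd M \<Longrightarrow> psd (transpose G ** M ** G)"
  by (simp only: psd_def inner_congruence) (simp add: matrix_transpose_mul matrix_mul_assoc)

lemma psd_mat_1: "psd (mat 1)"
  by (simp add: psd_def)

lemma psd_gram: "psd (transpose G ** G)" for G :: "real^'n^'m"
  using psd_congruence[OF psd_mat_1, of G] by simp

lemma psd_spectral:
  assumes "psd M"
  obtains U f where "orthogonal_matrix U" "M = spec U f" "\<And>i. 0 \<le> f i"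
  using spectral_theorem[OF psd_symmetric[OF assms]] assms by (metis psd_spec_iff)

lemma psd_trace_nonneg:
  assumes "psd M"
  shows "0 \<le> trace M"
  using assms by (elim psd_spectral) (simp add: trace_spec sum_nonneg)

lemma psd_trace_eq_0:
  assumes "psd M" "trace M = 0"
  shows "M = 0"
proof -
  obtain U f where U: "orthogonal_matrix U" "M = spec U f" and f: "\<And>i. 0 \<le> f i"
    using psd_spectral[OF assms(1)] by metis
  then have "f i = 0" for i
    using assms(2) by (simp add: trace_spec sum_nonneg_eq_0_iff)
  then show ?thesis by (simp add: U(2) vec_eq_iff spec_nth)
qed

text \<open>\<open>trace (transpose E ** E)\<close> is the squared Frobenius norm, so a Gram matrix
  vanishes only for \<open>E = 0\<close>. This is used twice: the fourth power of \<open>D\<close>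
  is the Gram matrix of \<open>D ** D\<close>, which is itself the Gram matrix of
  \<open>D\<close>.\<close>

lemma symmetric_cube_eq_0:
  fixes D :: "real^'n^'n"
  assumes "transpose D = D" "D ** D ** D = 0"
  shows "D = 0"
proof -
  have 1: "transpose E ** E = 0 \<Longrightarrow> E = 0" for E :: "real^'n^'n"
    using trace_transpose_mult[of E E] by (simp add: trace_def)
  have "transpose (D ** D) ** (D ** D) = 0"
    using assms by (simp add: matrix_transpose_mul matrix_mul_assoc matrix_mult_simps)
  then show ?thesis using 1[of "D ** D"] 1[of D] assms(1) by simp
qed

text \<open>The roots are not known to commute. Instead, \<open>D ** R + S ** D = 0\<close> for
  \<open>D = R - S\<close>; multiplying by \<open>D\<close> and taking traces makes two nonnegative
  traces cancel, so \<open>D ** R ** D\<close> and \<open>D ** S ** D\<close> both vanish, and their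
  difference is the cube of \<open>D\<close>.\<close>

lemma psd_sqrt_unique:
  fixes R S :: "real^'n^'n"
  assumes R: "psd R" and S: "psd S" and eq: "R ** R = S ** S"
  shows "R = S"
proof -
  define D where "D = R - S"
  have D: "transpose D = D" using R S by (simp add: D_def transpose_simps psd_symmetric)
  have "D ** R + S ** D = 0" using eq by (simp add: D_def matrix_mult_simps)
  then have "trace (D ** (D ** R + S ** D)) = 0" by (simp add: matrix_mult_simps trace_def)
  then have "trace (D ** R ** D) + trace (D ** S ** D) = 0"
    using trace_mul_sym[of D "D ** R"] by (simp add: matrix_mult_simps trace_add matrix_mul_assoc)
  moreover have "psd (D ** R ** D)" "psd (D ** S ** D)"
    using psd_congruence[of R D] psd_congruence[of S D] R S D by simp_all
  ultimately have "D ** R ** D = 0" "D ** S ** D = 0"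
    using psd_trace_nonneg[of "D ** R ** D"] psd_trace_nonneg[of "D ** S ** D"]
    by (auto intro!: psd_trace_eq_0)
  then have "D ** (R - S) ** D = 0" by (simp add: matrix_mult_simps)
  then have "D ** D ** D = 0" by (simp add: D_def)
  then show "R = S" using symmetric_cube_eq_0[OF D] by (simp add: D_def)
qed

lemma psd_sqrt:
  assumes "psd Q"
  shows "psd (psd_sqrt Q)" "psd_sqrt Q ** psd_sqrt Q = Q"
proof -
  obtain U f where U: "orthogonal_matrix U" "Q = spec U f" and f: "\<And>i. 0 \<le> f i"
    using psd_spectral[OF assms] by metis
  have R: "psd (spec U (\<lambda>i. sqrt (f i))) \<and>
      spec U (\<lambda>i. sqrt (f i)) ** spec U (\<lambda>i. sqrt (f i)) = Q"
    using U f by (simp add: psd_spec_iff spec_mult)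
  then have "\<exists>!R. psd R \<and> R ** R = Q"
    by (rule ex1I) (use R psd_sqrt_unique in blast)
  then have "psd (psd_sqrt Q) \<and> psd_sqrt Q ** psd_sqrt Q = Q"
    unfolding psd_sqrt_def by (rule theI')
  then show "psd (psd_sqrt Q)" "psd_sqrt Q ** psd_sqrt Q = Q" by simp_all
qed

text \<open>\<open>M ** X\<close> and \<open>M ** Y\<close> are both the orthogonal projection onto
  the range of \<open>M\<close>, and \<open>X ** M\<close> and \<open>Y ** M\<close> agree likewise;
  hence \<open>X = X ** M ** X = Y ** M ** Y = Y\<close>.\<close>

lemma is_pinv_unique:
  fixes M :: "real^'n^'m"
  assumes X: "is_pinv M X" and Y: "is_pinv M Y"
  shows "X = Y"
proof -
  have X': "M ** X ** M = M" "X ** M ** X = X" "transpose (M ** X) = M ** X" "transpose (X ** M) = X ** M"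
    and Y': "M ** Y ** M = M" "Y ** M ** Y = Y" "transpose (M ** Y) = M ** Y" "transpose (Y ** M) = Y ** M"
    using X Y by (auto simp: is_pinv_def)
  have "M ** X = transpose ((M ** Y) ** (M ** X))"
    by (simp only: matrix_mul_assoc X' Y')
  also have "\<dots> = M ** X ** (M ** Y)"
    by (simp only: matrix_transpose_mul[of "M ** Y"] X' Y')
  also have "\<dots> = M ** Y"
    by (simp only: matrix_mul_assoc X' Y')
  finally have 1: "M ** X = M ** Y" .
  have "X ** M = transpose (X ** M ** Y ** M)"
    by (simp only: matrix_mul_assoc[symmetric, of X] Y') (simp only: X' matrix_mul_assoc)
  also have "X ** M ** Y ** M = (X ** M) ** (Y ** M)"
    by (simp only: matrix_mul_assoc)
  also have "transpose \<dots> = Y ** M ** (X ** M)"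
    by (simp only: matrix_transpose_mul[of "X ** M"] X' Y')
  also have "\<dots> = Y ** (M ** X ** M)"
    by (simp only: matrix_mul_assoc)
  finally have 2: "X ** M = Y ** M" by (simp only: X')
  have "X = X ** M ** X" by (simp only: X')
  also have "\<dots> = Y ** (M ** X)" by (simp only: 2 matrix_mul_assoc)
  also have "\<dots> = Y ** M ** Y" by (simp only: 1 matrix_mul_assoc)
  finally show ?thesis by (simp only: Y')
qed

text \<open>Since \<open>1 / 0 = 0\<close>, inverting the eigenvalues leaves the kernel alone.\<close>

lemma pinv_spec:
  assumes "orthogonal_matrix U"
  shows "pinv (spec U f) = spec U (\<lambda>i. 1 / f i)"
proof -
  have "f i * (1 / f i) * f i = f i" "1 / f i * f i * (1 / f i) = 1 / f i" for i by simp_all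
  then have pinv: "is_pinv (spec U f) (spec U (\<lambda>i. 1 / f i))"
    by (simp only: is_pinv_def spec_mult[OF assms] transpose_spec simp_thms)
  then show ?thesis
    unfolding pinv_def by (rule the_equality) (rule is_pinv_unique[OF _ pinv])
qed

text \<open>\<open>M ** N\<close> is in general not symmetric, but moving one square root of
  \<open>M\<close> around the trace leaves a congruence of \<open>N\<close>.\<close>

lemma trace_psd_mult_nonneg:
  assumes "psd M" "psd N"
  shows "0 \<le> trace (M ** N)"
proof -
  have "trace (M ** N) = trace (psd_sqrt M ** N ** psd_sqrt M)"
    using trace_mul_sym[of "psd_sqrt M" "psd_sqrt M ** N"] psd_sqrt(2)[OF assms(1)]
    by (simp add: matrix_mul_assoc)
  moreover have "psd (psd_sqrt M ** N ** psd_sqrt M)"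
    using psd_congruence[OF assms(2), of "psd_sqrt M"] psd_symmetric[OF psd_sqrt(1)[OF assms(1)]]
    by simp
  ultimately show ?thesis by (simp add: psd_trace_nonneg)
qed

subsection \<open>Powers and the exponential of a matrix\<close>

text \<open>The library's \<open>A ^ n\<close> multiplies matrices entry by entry.\<close>

primrec mpow :: "real^'n^'n \<Rightarrow> nat \<Rightarrow> real^'n^'n" where
  "mpow A 0 = mat 1"
| "mpow A (Suc n) = A ** mpow A n"

lemma mpow_add: "mpow A (m + n) = mpow A m ** mpow A n"
  by (induction m) (simp_all add: matrix_mul_assoc)

lemma mpow_mult: "mpow A (m * n) = mpow (mpow A m) n"
  by (induction n) (simp_all add: mpow_add)

lemma mpow_Suc_right: "mpow A (Suc n) = mpow A n ** A"
  using mpow_add[of A n 1] by simp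

lemma transpose_mpow: "transpose (mpow A n) = mpow (transpose A) n"
proof (induction n)
  case (Suc n)
  then show ?case
    by (simp only: mpow.simps(2)[of A] matrix_transpose_mul mpow_Suc_right[of "transpose A"])
qed simp

lemma mpow_mult_rotate: "mpow (X ** Y) n ** X = X ** mpow (Y ** X) n"
proof (induction n)
  case (Suc n)
  have "mpow (X ** Y) (Suc n) ** X = X ** Y ** (mpow (X ** Y) n ** X)" by (simp add: matrix_mul_assoc)
  then show ?case by (simp add: Suc matrix_mul_assoc)
qed simp

lemma trace_mpow_mult:
  fixes X Y :: "real^'n^'n"
  shows "trace (mpow (X ** Y) n) = trace (mpow (Y ** X) n)"
proof (cases n)
  case (Suc m)
  have "mpow (X ** Y) n = (X ** mpow (Y ** X) m) ** Y"
    by (simp only: Suc mpow_Suc_right matrix_mul_assoc mpow_mult_rotate[of X Y, symmetric])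
  also have "trace \<dots> = trace (Y ** (X ** mpow (Y ** X) m))" by (rule trace_mul_sym)
  also have "\<dots> = trace (mpow (Y ** X) n)" by (simp add: Suc matrix_mul_assoc)
  finally show ?thesis .
qed simp

lemma mpow_spec: "orthogonal_matrix U \<Longrightarrow> mpow (spec U f) n = spec U (\<lambda>i. f i ^ n)"
  by (induction n) (simp_all add: spec_one spec_mult)

text \<open>Euler's limit is chosen because Golden--Thompson comes from an inequality between
  powers, and the exponents are \<open>2 ^ k\<close> because that inequality is proved by
  doubling.\<close>

definition mexp :: "real^'n^'n \<Rightarrow> real^'n^'n" where
  "mexp Y = lim (\<lambda>k. mpow (mat 1 + (1 / 2 ^ k) *\<^sub>R Y) (2 ^ k))"

lemma tendsto_exp_limit_two_power: "(\<lambda>k. (1 + x / 2 ^ k) ^ (2 ^ k)) \<longlonglongrightarrow> exp (x :: real)"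
proof -
  have "strict_mono (\<lambda>k. 2 ^ k :: nat)" by (simp add: strict_mono_def)
  from LIMSEQ_subseq_LIMSEQ[OF tendsto_exp_limit_sequentially this, of x]
  show ?thesis by (simp add: o_def)
qed

lemma mexp_spec_limit:
  assumes "orthogonal_matrix U"
  shows "(\<lambda>k. mpow (mat 1 + (1 / 2 ^ k) *\<^sub>R spec U f) (2 ^ k)) \<longlonglongrightarrow> spec U (\<lambda>i. exp (f i))"
proof -
  have "mpow (mat 1 + (1 / 2 ^ k) *\<^sub>R spec U f) (2 ^ k) = spec U (\<lambda>i. (1 + f i / 2 ^ k) ^ (2 ^ k))" for k
    by (simp add: spec_one[OF assms, symmetric] spec_linear mpow_spec[OF assms])
  moreover have "(\<lambda>k. spec U (\<lambda>i. (1 + f i / 2 ^ k) ^ (2 ^ k))) \<longlonglongrightarrow> spec U (\<lambda>i. exp (f i))"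
    by (intro vec_tendstoI) (auto simp: spec_nth intro!: tendsto_intros tendsto_exp_limit_two_power)
  ultimately show ?thesis by simp
qed

lemma mexp_spec: "orthogonal_matrix U \<Longrightarrow> mexp (spec U f) = spec U (\<lambda>i. exp (f i))"
  unfolding mexp_def by (intro limI mexp_spec_limit)

lemma mexp_limit:
  assumes "transpose Y = Y"
  shows "(\<lambda>k. mpow (mat 1 + (1 / 2 ^ k) *\<^sub>R Y) (2 ^ k)) \<longlonglongrightarrow> mexp Y"
proof -
  obtain U f where "orthogonal_matrix U" "Y = spec U f" using spectral_theorem[OF assms] .
  then show ?thesis by (simp add: mexp_spec mexp_spec_limit)
qed

lemma mexp_zero: "mexp (0 :: real^'n^'n) = mat 1"
proof -
  have "(0 :: real^'n^'n) = spec (mat 1) (\<lambda>_. 0)" by (simp add: vec_eq_iff spec_nth)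
  then show ?thesis
    using mexp_spec[of "mat 1 :: real^'n^'n" "\<lambda>_. 0"] by (simp add: orthogonal_matrix_id spec_one)
qed

lemma psd_mexp:
  assumes "transpose Y = Y"
  shows "psd (mexp Y)"
proof -
  obtain U f where "orthogonal_matrix U" "Y = spec U f" using spectral_theorem[OF assms] .
  then show ?thesis by (simp add: mexp_spec psd_spec_iff)
qed

text \<open>The Rayleigh quotient at \<open>x\<close> is a weighted average of eigenvalues, so one
  of them reaches \<open>t\<close>; its exponential is one of the positive terms of the
  trace.\<close>

lemma exp_le_trace_mexp:
  fixes Y :: "real^'n^'n"
  assumes Y: "transpose Y = Y" and x: "x \<noteq> 0" "t * (x \<bullet> x) \<le> x \<bullet> (Y *v x)"
  shows "exp t \<le> trace (mexp Y)"
proof -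
  obtain U f where U: "orthogonal_matrix U" "Y = spec U f"
    using spectral_theorem[OF Y] .
  have "\<exists>i. t \<le> f i"
  proof (rule ccontr)
    assume "\<not> ?thesis"
    then have lt: "f i < t" for i by (simp add: not_le)
    have sq: "(\<Sum>i\<in>UNIV. ((U *v x) $ i)\<^sup>2) = x \<bullet> x" by (rule sum_square_orthogonal[OF U(1)])
    then obtain j where j: "(U *v x) $ j \<noteq> 0"
      using x(1) by (metis (mono_tags, lifting) inner_eq_zero_iff power_zero_numeral sum.neutral)
    have "x \<bullet> (Y *v x) = (\<Sum>i\<in>UNIV. f i * ((U *v x) $ i)\<^sup>2)" by (simp add: U(2) inner_spec)
    also have "\<dots> < (\<Sum>i\<in>UNIV. t * ((U *v x) $ i)\<^sup>2)"
    proof (rule sum_strict_mono_ex1)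
      show "\<forall>i\<in>UNIV. f i * ((U *v x) $ i)\<^sup>2 \<le> t * ((U *v x) $ i)\<^sup>2"
        using lt by (simp add: less_imp_le mult_right_mono)
      show "\<exists>i\<in>UNIV. f i * ((U *v x) $ i)\<^sup>2 < t * ((U *v x) $ i)\<^sup>2"
        using lt j by (intro bexI[of _ j]) simp_all
    qed simp
    also have "\<dots> = t * (x \<bullet> x)" by (simp add: sq flip: sum_distrib_left)
    finally show False using x(2) by simp
  qed
  then obtain i where "t \<le> f i" ..
  then have "exp t \<le> exp (f i)" by simp
  also have "\<dots> \<le> (\<Sum>i\<in>UNIV. exp (f i))" by (rule member_le_sum) auto
  finally show ?thesis by (simp add: U mexp_spec trace_spec)
qed

subsection \<open>The Golden--Thompson inequality\<close>

lemma trace_mult_le_squares: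
  fixes A B :: "real^'n^'n"
  shows "2 * trace (transpose A ** B) \<le> trace (transpose A ** A) + trace (transpose B ** B)"
proof -
  have "0 \<le> (A - B) \<bullet> (A - B)" by simp
  then show ?thesis
    by (simp add: trace_transpose_mult inner_diff_left inner_diff_right inner_commute)
qed

text \<open>The two inequalities feed each other in the induction.\<close>

lemma trace_mpow_mult_le_aux:
  shows "(\<forall>A B :: real^'n^'n. transpose A = A \<longrightarrow> transpose B = B \<longrightarrow>
      trace (mpow (A ** B) (2 ^ k)) \<le> trace (mpow A (2 ^ k) ** mpow B (2 ^ k))) \<and>
    (\<forall>M :: real^'n^'n. trace (mpow M (2 ^ Suc k)) \<le> trace (mpow (M ** transpose M) (2 ^ k)))"
proof (induction k)
  case 0
  have "trace (M ** M) \<le> trace (M ** transpose M)" for M :: "real^'n^'n"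
    using trace_mult_le_squares[of "transpose M" M] trace_mul_sym[of M "transpose M"] by simp
  then show ?case by (simp add: numeral_2_eq_2)
next
  case (Suc k)
  let ?N = "2 ^ k :: nat"
  have T: "trace (mpow (A ** B) ?N) \<le> trace (mpow A ?N ** mpow B ?N)"
    if "transpose A = A" "transpose B = B" for A B :: "real^'n^'n"
    using Suc.IH that by blast
  have K: "trace (mpow M (2 * ?N)) \<le> trace (mpow (M ** transpose M) ?N)" for M :: "real^'n^'n"
    using Suc.IH by simp
  have sq: "mpow A (2 * m) = mpow (A ** A) m" for A :: "real^'n^'n" and m
    using mpow_mult[of A 2 m] by (simp add: numeral_2_eq_2)
  have "trace (mpow (A ** B) (2 * ?N)) \<le> trace (mpow A (2 * ?N) ** mpow B (2 * ?N))"
    if AB: "transpose A = A" "transpose B = B" for A B :: "real^'n^'n"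
  proof -
    \<comment> \<open>\<open>K\<close> halves the exponent at the price of the symmetric matrix
      \<open>A ** B ** B ** A\<close>, which rotates inside the trace into a product of the squares
      of \<open>A\<close> and \<open>B\<close>, where \<open>T\<close> applies.\<close>
    have "trace (mpow (A ** B) (2 * ?N)) \<le> trace (mpow ((A ** B) ** transpose (A ** B)) ?N)"
      by (rule K)
    also have "(A ** B) ** transpose (A ** B) = A ** (B ** B ** A)"
      by (simp add: matrix_transpose_mul AB matrix_mul_assoc)
    also have "trace (mpow \<dots> ?N) = trace (mpow ((B ** B) ** (A ** A)) ?N)"
      by (subst trace_mpow_mult) (simp add: matrix_mul_assoc)
    also have "\<dots> = trace (mpow ((A ** A) ** (B ** B)) ?N)"
      by (rule trace_mpow_mult)
    also have "\<dots> \<le> trace (mpow (A ** A) ?N ** mpow (B ** B) ?N)"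
      by (rule T) (simp_all add: matrix_transpose_mul AB)
    finally show ?thesis by (simp add: sq)
  qed
  moreover have "trace (mpow M (2 * (2 * ?N))) \<le> trace (mpow (M ** transpose M) (2 * ?N))"
    for M :: "real^'n^'n"
  proof -
    let ?P = "transpose M ** M" and ?R = "M ** transpose M"
    have sym: "transpose ?P = ?P" "transpose ?R = ?R" by (simp_all add: matrix_transpose_mul)
    \<comment> \<open>Applied to \<open>M ** M\<close>, \<open>K\<close> yields a matrix that
      rotates into \<open>?P ** ?R\<close>, a product of symmetric factors fit for \<open>T\<close>.
      Cauchy--Schwarz then separates the factors, and their powers have equal traces because they
      differ only in the order of \<open>M\<close> and its transpose.\<close>
    have "trace (mpow M (2 * (2 * ?N))) = trace (mpow (M ** M) (2 * ?N))"
      by (simp only: sq)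
    also have "\<dots> \<le> trace (mpow ((M ** M) ** transpose (M ** M)) ?N)" by (rule K)
    also have "(M ** M) ** transpose (M ** M) = (M ** ?R) ** transpose M"
      by (simp add: matrix_transpose_mul matrix_mul_assoc)
    also have "trace (mpow \<dots> ?N) = trace (mpow (transpose M ** (M ** ?R)) ?N)"
      by (rule trace_mpow_mult)
    also have "transpose M ** (M ** ?R) = ?P ** ?R" by (simp add: matrix_mul_assoc)
    also have "trace (mpow (?P ** ?R) ?N) \<le> trace (mpow ?P ?N ** mpow ?R ?N)"
      by (rule T) (simp_all only: sym)
    also have "2 * \<dots> \<le> trace (mpow ?P (2 * ?N)) + trace (mpow ?R (2 * ?N))"
      using trace_mult_le_squares[of "mpow ?P ?N" "mpow ?R ?N"]
      by (simp only: transpose_mpow sym mult_2 mpow_add)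
    also have "trace (mpow ?P (2 * ?N)) = trace (mpow ?R (2 * ?N))"
      by (rule trace_mpow_mult)
    finally show ?thesis by simp
  qed
  ultimately show ?case by (simp only: power_Suc) blast
qed

lemma trace_mpow_mult_le:
  fixes A B :: "real^'n^'n"
  assumes "transpose A = A" "transpose B = B"
  shows "trace (mpow (A ** B) (2 ^ k)) \<le> trace (mpow A (2 ^ k) ** mpow B (2 ^ k))"
  using trace_mpow_mult_le_aux[where 'n='n] assms by blast

section \<open>Operator norm bounds and the Lie--Trotter formula\<close>

lemma norm_mpow_mult_le:
  fixes A :: "real^'n^'n"
  assumes A: "\<And>x. norm (A *v x) \<le> a * norm x" and a: "0 \<le> a"
  shows "norm (mpow A n *v x) \<le> a ^ n * norm x"
proof (induction n)
  case (Suc n)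
  have "norm (A *v (mpow A n *v x)) \<le> a * norm (mpow A n *v x)" by (rule A)
  also have "\<dots> \<le> a * (a ^ n * norm x)" by (rule mult_left_mono[OF Suc a])
  finally show ?case by (simp add: matrix_vector_mul_assoc mult.assoc)
qed simp

text \<open>Telescoping: the difference of powers grows by \<open>A\<close> times the previous
  difference plus \<open>A - B\<close> times a power of \<open>B\<close>. With
  \<open>1 \<le> a\<close> the powers of \<open>a\<close> can be rounded up to a common one.\<close>

lemma norm_mpow_diff_le:
  fixes A B :: "real^'n^'n"
  assumes A: "\<And>x. norm (A *v x) \<le> a * norm x" and B: "\<And>x. norm (B *v x) \<le> a * norm x"
    and AB: "\<And>x. norm ((A - B) *v x) \<le> c * norm x" and a: "1 \<le> a" and c: "0 \<le> c"
  shows "norm ((mpow A n - mpow B n) *v x) \<le> n * a ^ n * c * norm x"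
proof (induction n)
  case (Suc n)
  have "(mpow A (Suc n) - mpow B (Suc n)) *v x =
      A *v ((mpow A n - mpow B n) *v x) + (A - B) *v (mpow B n *v x)"
    by (simp add: matrix_vector_mul_assoc matrix_mult_simps flip: matrix_vector_mult_add_rdistrib)
  also have "norm \<dots> \<le> a * (n * a ^ n * c * norm x) + c * (a ^ n * norm x)"
  proof (rule norm_triangle_mono)
    show "norm (A *v ((mpow A n - mpow B n) *v x)) \<le> a * (n * a ^ n * c * norm x)"
      using A Suc a by (meson mult_left_mono order_trans zero_le_one)
    have "norm (mpow B n *v x) \<le> a ^ n * norm x"
      using norm_mpow_mult_le[of B a, OF B] a by simp
    then show "norm ((A - B) *v (mpow B n *v x)) \<le> c * (a ^ n * norm x)"
      using AB c by (meson mult_left_mono order_trans)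
  qed
  also have "c * (a ^ n * norm x) \<le> c * (a ^ Suc n * norm x)"
    using a c by (intro mult_left_mono mult_right_mono power_increasing) auto
  finally show ?case by (simp add: algebra_simps)
qed simp

lemma matrix_vector_norm_bound:
  fixes Y :: "real^'n^'n"
  obtains y where "0 \<le> y" "\<And>x. norm (Y *v x) \<le> y * norm x"
proof -
  obtain y where "\<And>x. norm (Y *v x) \<le> y * norm x"
    using linear_bounded[of "(*v) Y"] by auto
  then have "norm (Y *v x) \<le> max 0 y * norm x" for x
    by (meson max.cobounded2 mult_right_mono norm_ge_zero order_trans)
  then show ?thesis using that[of "max 0 y"] by simp
qed

lemma trace_norm_bound:
  fixes M :: "real^'n^'n" and c :: real
  assumes "\<And>x. norm (M *v x) \<le> c * norm x"
  shows "\<bar>trace M\<bar> \<le> CARD('n) * c"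
proof -
  have "\<bar>M $ i $ i\<bar> \<le> c" for i
  proof -
    have "\<bar>M $ i $ i\<bar> = \<bar>(M *v axis i 1) $ i\<bar>"
      by (simp add: matrix_vector_mult_basis column_def)
    also have "\<dots> \<le> norm (M *v axis i 1)" by (rule component_le_norm_cart)
    also have "\<dots> \<le> c * norm (axis i 1 :: real^'n)" by (rule assms)
    finally show ?thesis by simp
  qed
  then have "(\<Sum>i\<in>UNIV. \<bar>M $ i $ i\<bar>) \<le> (\<Sum>i\<in>(UNIV :: 'n set). c)" by (intro sum_mono)
  moreover have "\<bar>trace M\<bar> \<le> (\<Sum>i\<in>UNIV. \<bar>M $ i $ i\<bar>)"
    unfolding trace_def by (rule sum_abs)
  ultimately show ?thesis by simp
qed

lemma norm_mat_1_plus_le: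
  fixes Y :: "real^'n^'n"
  assumes "0 \<le> h" "\<And>x. norm (Y *v x) \<le> y * norm x"
  shows "norm ((mat 1 + h *\<^sub>R Y) *v x) \<le> exp (h * y) * norm x"
proof -
  have "norm ((mat 1 + h *\<^sub>R Y) *v x) \<le> norm x + h * (y * norm x)"
    unfolding matrix_vector_mult_add_rdistrib scaleR_matrix_vector_mult
    using assms by (intro norm_triangle_mono) (auto intro!: mult_left_mono)
  also have "\<dots> = (1 + h * y) * norm x" by (simp add: algebra_simps)
  also have "\<dots> \<le> exp (h * y) * norm x" by (intro mult_right_mono exp_ge_add_one_self) simp
  finally show ?thesis .
qed

text \<open>With \<open>h = 1 / 2 ^ k\<close> the two bases differ by exactly
  \<open>(h * h) *\<^sub>R (Y ** Z)\<close>. The power multiplies this error by \<open>2 ^ k\<close>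
  and by a factor that stays at \<open>exp (y + z)\<close>, so it is of order
  \<open>h\<close>.\<close>

lemma trace_lie_trotter:
  fixes Y Z :: "real^'n^'n"
  shows "(\<lambda>k. trace (mpow ((mat 1 + (1 / 2 ^ k) *\<^sub>R Y) ** (mat 1 + (1 / 2 ^ k) *\<^sub>R Z)) (2 ^ k))
      - trace (mpow (mat 1 + (1 / 2 ^ k) *\<^sub>R (Y + Z)) (2 ^ k))) \<longlonglongrightarrow> 0"
    (is "(\<lambda>k. trace (mpow (?A k) _) - trace (mpow (?B k) _)) \<longlonglongrightarrow> 0")
proof -
  obtain y where y: "0 \<le> y" "\<And>x. norm (Y *v x) \<le> y * norm x"
    using matrix_vector_norm_bound[of Y] by metis
  obtain z where z: "0 \<le> z" "\<And>x. norm (Z *v x) \<le> z * norm x"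
    using matrix_vector_norm_bound[of Z] by metis
  define C where "C = CARD('n) * exp (y + z) * y * z"
  have "\<bar>trace (mpow (?A k) (2 ^ k)) - trace (mpow (?B k) (2 ^ k))\<bar> \<le> C / 2 ^ k" for k
  proof -
    define h where "h = 1 / (2 ^ k :: real)"
    have h: "0 \<le> h" "h * 2 ^ k = 1" by (simp_all add: h_def)
    have hY: "norm ((mat 1 + h *\<^sub>R Y) *v x) \<le> exp (h * y) * norm x" for x
      using h(1) y(2) by (rule norm_mat_1_plus_le)
    have hZ: "norm ((mat 1 + h *\<^sub>R Z) *v x) \<le> exp (h * z) * norm x" for x
      using h(1) z(2) by (rule norm_mat_1_plus_le)
    have A: "norm (?A k *v x) \<le> exp (h * (y + z)) * norm x" for x
    proof -
      have "norm (?A k *v x) \<le> exp (h * y) * norm ((mat 1 + h *\<^sub>R Z) *v x)"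
        using hY[of "(mat 1 + h *\<^sub>R Z) *v x"] by (simp add: matrix_vector_mul_assoc h_def)
      also have "\<dots> \<le> exp (h * y) * (exp (h * z) * norm x)" by (intro mult_left_mono hZ) simp
      finally show ?thesis by (simp add: exp_add distrib_left mult.assoc)
    qed
    have "norm ((Y + Z) *v x) \<le> (y + z) * norm x" for x
      using norm_triangle_mono[OF y(2) z(2)] by (simp add: matrix_vector_mult_add_rdistrib distrib_right)
    then have B: "norm (?B k *v x) \<le> exp (h * (y + z)) * norm x" for x
      using norm_mat_1_plus_le[OF h(1), of "Y + Z"] by (simp add: h_def)
    have AB: "norm ((?A k - ?B k) *v x) \<le> h * h * (y * z) * norm x" for x
    proof -
      have "?A k - ?B k = (h * h) *\<^sub>R (Y ** Z)"
        unfolding h_def[symmetric] by (simp add: matrix_mult_simps algebra_simps)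
      then have "norm ((?A k - ?B k) *v x) = h * h * norm (Y *v (Z *v x))"
        using h by (simp add: scaleR_matrix_vector_mult matrix_vector_mul_assoc)
      also have "\<dots> \<le> h * h * (y * (z * norm x))"
        using h y(1) order_trans[OF y(2) mult_left_mono[OF z(2)]] by (intro mult_left_mono) auto
      finally show ?thesis by (simp add: mult.assoc)
    qed
    have "norm ((mpow (?A k) (2 ^ k) - mpow (?B k) (2 ^ k)) *v x) \<le>
        real (2 ^ k) * exp (h * (y + z)) ^ (2 ^ k) * (h * h * (y * z)) * norm x" for x
      by (rule norm_mpow_diff_le[OF A B AB]) (use h y z in auto)
    from trace_norm_bound[OF this]
    have "\<bar>trace (mpow (?A k) (2 ^ k)) - trace (mpow (?B k) (2 ^ k))\<bar> \<le>
        CARD('n) * (2 ^ k * exp (h * (y + z)) ^ (2 ^ k) * (h * h * (y * z)))"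
      by (simp add: trace_sub)
    also have "exp (h * (y + z)) ^ (2 ^ k) = exp (y + z)"
      using h by (simp add: exp_of_nat_mult[symmetric] mult.assoc[symmetric] mult.commute)
    also have "CARD('n) * (2 ^ k * exp (y + z) * (h * h * (y * z))) = C / 2 ^ k"
      by (simp add: C_def h_def)
    finally show ?thesis .
  qed
  then have "\<forall>\<^sub>F k in sequentially.
      norm (trace (mpow (?A k) (2 ^ k)) - trace (mpow (?B k) (2 ^ k))) \<le> C / 2 ^ k"
    by (intro always_eventually allI) (simp only: real_norm_def)
  moreover have "(\<lambda>k. C / 2 ^ k) \<longlonglongrightarrow> 0" by (rule LIMSEQ_divide_realpow_zero) simp
  ultimately show ?thesis by (rule Lim_null_comparison)
qed

lemma tendsto_trace [tendsto_intros]: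
  fixes F :: "'a \<Rightarrow> real^'n^'n"
  shows "(F \<longlongrightarrow> L) G \<Longrightarrow> ((\<lambda>k. trace (F k)) \<longlongrightarrow> trace L) G"
  unfolding trace_def by (intro tendsto_intros)

lemma tendsto_matrix_mult [tendsto_intros]:
  fixes F :: "'a \<Rightarrow> real^'n^'m" and K :: "'a \<Rightarrow> real^'p^'n"
  shows "(F \<longlongrightarrow> L) G \<Longrightarrow> (K \<longlongrightarrow> M) G \<Longrightarrow> ((\<lambda>k. F k ** K k) \<longlongrightarrow> L ** M) G"
  by (intro vec_tendstoI) (auto simp: matrix_matrix_mult_def intro!: tendsto_intros)

text \<open>The limit of \<open>trace_mpow_mult_le\<close> at the first-order factors of
  \<open>Y\<close> and \<open>Z\<close>: Lie--Trotter identifies the left side, and the powers on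
  the right converge separately.\<close>

theorem golden_thompson:
  fixes Y Z :: "real^'n^'n"
  assumes Y: "transpose Y = Y" and Z: "transpose Z = Z"
  shows "trace (mexp (Y + Z)) \<le> trace (mexp Y ** mexp Z)"
proof (rule LIMSEQ_le)
  let ?f = "\<lambda>k Y. mat 1 + (1 / 2 ^ k) *\<^sub>R (Y :: real^'n^'n)"
  have "transpose (Y + Z) = Y + Z" by (simp add: Y Z transpose_simps)
  from tendsto_add[OF trace_lie_trotter[of Y Z] tendsto_trace[OF mexp_limit[OF this]]]
  show "(\<lambda>k. trace (mpow (?f k Y ** ?f k Z) (2 ^ k))) \<longlonglongrightarrow> trace (mexp (Y + Z))"
    by simp
  show "(\<lambda>k. trace (mpow (?f k Y) (2 ^ k) ** mpow (?f k Z) (2 ^ k))) \<longlonglongrightarrow> trace (mexp Y ** mexp Z)"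
    by (intro tendsto_intros mexp_limit Y Z)
  show "\<exists>N. \<forall>k\<ge>N. trace (mpow (?f k Y ** ?f k Z) (2 ^ k)) \<le>
      trace (mpow (?f k Y) (2 ^ k) ** mpow (?f k Z) (2 ^ k))"
    by (intro exI allI impI trace_mpow_mult_le) (simp_all add: transpose_simps Y Z)
qed

subsection \<open>Concentration for Bernoulli sums of matrices\<close>

text \<open>The probability that the sampled set agrees with \<open>S\<close> on \<open>J\<close>;
  \<open>J\<close> is a parameter so that indices can be removed by induction.\<close>

definition bernoulli_weight :: "('i \<Rightarrow> real) \<Rightarrow> 'i set \<Rightarrow> 'i set \<Rightarrow> real" where
  "bernoulli_weight q J S = (\<Prod>i\<in>J. if i \<in> S then q i else 1 - q i)"

lemma bernoulli_weight_nonneg: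
  "(\<And>i. 0 \<le> q i) \<Longrightarrow> (\<And>i. q i \<le> 1) \<Longrightarrow> 0 \<le> bernoulli_weight q J S"
  unfolding bernoulli_weight_def by (intro prod_nonneg) simp

text \<open>Reduces every probability to a finite weighted sum, so that the concentration argument
  is free of measure theory. There are finitely many sampled sets, so each predicate
  \<open>P\<close> defines a finite disjoint union of the events \<open>E S\<close>.\<close>

lemma (in prob_space) prob_bernoulli_family:
  fixes \<xi> :: "'n::finite \<Rightarrow> 'a \<Rightarrow> bool"
  assumes indep: "indep_vars (\<lambda>_. count_space UNIV) \<xi> UNIV"
    and q: "\<And>i. prob {\<omega> \<in> space M. \<xi> i \<omega>} = q i"
  shows "prob {\<omega> \<in> space M. P {i. \<xi> i \<omega>}} = (\<Sum>S | P S. bernoulli_weight q UNIV S)"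
proof -
  define E where "E S = {\<omega> \<in> space M. {i. \<xi> i \<omega>} = S}" for S
  have meas: "\<xi> i \<in> measurable M (count_space UNIV)" for i
    using indep by (auto simp: indep_vars_def)
  have E_eq: "E S = (\<Inter>i\<in>UNIV. \<xi> i -` {i \<in> S} \<inter> space M)" for S
    by (auto simp: E_def)
  have pre: "\<xi> i -` B \<inter> space M \<in> events" for i B
    using meas[of i] by (rule measurable_sets) simp
  have ev: "E S \<in> events" for S
    unfolding E_eq by (intro sets.finite_INT pre) auto
  have prob_E: "prob (E S) = bernoulli_weight q UNIV S" for S
  proof -
    have "prob (E S) = (\<Prod>i\<in>UNIV. prob (\<xi> i -` {i \<in> S} \<inter> space M))"
      unfolding E_eq by (rule indep_varsD_finite[OF indep]) auto
    also have "\<dots> = bernoulli_weight q UNIV S"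
      unfolding bernoulli_weight_def
    proof (rule prod.cong[OF refl])
      fix i
      have T: "\<xi> i -` {True} \<inter> space M = {\<omega> \<in> space M. \<xi> i \<omega>}" by auto
      have F: "\<xi> i -` {False} \<inter> space M = space M - (\<xi> i -` {True} \<inter> space M)" by auto
      have "prob (\<xi> i -` {False} \<inter> space M) = 1 - q i"
        unfolding F using prob_compl[OF pre[of i "{True}"]] by (simp add: T q)
      then show "prob (\<xi> i -` {i \<in> S} \<inter> space M) = (if i \<in> S then q i else 1 - q i)"
        by (cases "i \<in> S") (simp_all add: T q)
    qed
    finally show ?thesis .
  qed
  have "{\<omega> \<in> space M. P {i. \<xi> i \<omega>}} = (\<Union>S\<in>Collect P. E S)"
    by (auto simp: E_def)
  also have "prob \<dots> = (\<Sum>S | P S. prob (E S))"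
    by (rule finite_measure_finite_Union) (use ev in \<open>auto simp: E_def disjoint_family_on_def\<close>)
  finally show ?thesis by (simp add: prob_E)
qed

text \<open>One index is averaged out while the others are held fixed, and this does not increase
  the trace; with no index left, the trace of the identity remains, which is the dimension.\<close>

lemma bernoulli_trace_mexp_le:
  fixes Z :: "'i \<Rightarrow> bool \<Rightarrow> real^'d^'d"
  assumes sym: "\<And>i b. transpose (Z i b) = Z i b"
    and q: "\<And>i. 0 \<le> q i" "\<And>i. q i \<le> 1"
    and mean: "\<And>i. psd (mat 1 - (q i *\<^sub>R mexp (Z i True) + (1 - q i) *\<^sub>R mexp (Z i False)))"
    and J: "finite J"
  shows "(\<Sum>S\<in>Pow J. bernoulli_weight q J S * trace (mexp (\<Sum>i\<in>J. Z i (i \<in> S)))) \<le> CARD('d)"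
  using J
proof (induction J rule: finite_induct)
  case empty
  then show ?case by (simp add: bernoulli_weight_def mexp_zero trace_I)
next
  case (insert i J)
  let ?w = "bernoulli_weight q" and ?Y = "\<lambda>J S. \<Sum>i\<in>J. Z i (i \<in> S)"
  have eqs: "?w (insert i J) S = (1 - q i) * ?w J S" "?w (insert i J) (insert i S) = q i * ?w J S"
    "?Y (insert i J) S = ?Y J S + Z i False" "?Y (insert i J) (insert i S) = ?Y J S + Z i True"
    if "S \<in> Pow J" for S
  proof -
    have "i \<notin> S" using that insert.hyps by auto
    moreover have "?w J (insert i S) = ?w J S"
      unfolding bernoulli_weight_def using insert.hyps by (intro prod.cong) auto
    moreover have "?Y J (insert i S) = ?Y J S"
      using insert.hyps by (intro sum.cong refl arg_cong2[where f = Z]) auto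
    ultimately show "?w (insert i J) S = (1 - q i) * ?w J S" "?w (insert i J) (insert i S) = q i * ?w J S"
      "?Y (insert i J) S = ?Y J S + Z i False" "?Y (insert i J) (insert i S) = ?Y J S + Z i True"
      using insert.hyps by (simp_all add: bernoulli_weight_def add.commute)
  qed
  have step: "q i * trace (mexp (Y + Z i True)) + (1 - q i) * trace (mexp (Y + Z i False)) \<le> trace (mexp Y)"
    if Y: "transpose Y = Y" for Y
  proof -
    have "q i * trace (mexp (Y + Z i True)) + (1 - q i) * trace (mexp (Y + Z i False)) \<le>
        q i * trace (mexp Y ** mexp (Z i True)) + (1 - q i) * trace (mexp Y ** mexp (Z i False))"
      using q by (intro add_mono mult_left_mono golden_thompson sym Y) auto
    \<comment> \<open>The trace is linear in its second factor, so both outcomes merge into the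
      average that \<open>mean\<close> compares with the identity.\<close>
    also have "\<dots> = trace (mexp Y) -
        trace (mexp Y ** (mat 1 - (q i *\<^sub>R mexp (Z i True) + (1 - q i) *\<^sub>R mexp (Z i False))))"
      by (simp only: matrix_mult_simps trace_add trace_sub trace_simps matrix_mul_rid)
    also have "\<dots> \<le> trace (mexp Y)"
      using trace_psd_mult_nonneg[OF psd_mexp[OF Y] mean[of i]] by simp
    finally show ?thesis .
  qed
  \<comment> \<open>The subsets of \<open>insert i J\<close> come in pairs \<open>S\<close>,
    \<open>insert i S\<close>, the two outcomes of index \<open>i\<close>.\<close>
  have "(\<Sum>S\<in>Pow (insert i J). ?w (insert i J) S * trace (mexp (?Y (insert i J) S))) =
      (\<Sum>S\<in>Pow J. ?w (insert i J) S * trace (mexp (?Y (insert i J) S))) +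
      (\<Sum>S\<in>insert i ` Pow J. ?w (insert i J) S * trace (mexp (?Y (insert i J) S)))"
    unfolding Pow_insert using insert.hyps by (intro sum.union_disjoint) auto
  also have "(\<Sum>S\<in>insert i ` Pow J. ?w (insert i J) S * trace (mexp (?Y (insert i J) S))) =
      (\<Sum>S\<in>Pow J. ?w (insert i J) (insert i S) * trace (mexp (?Y (insert i J) (insert i S))))"
    by (rule sum.reindex[unfolded o_def]) (use insert.hyps in \<open>auto simp: inj_on_def\<close>)
  also have "(\<Sum>S\<in>Pow J. ?w (insert i J) S * trace (mexp (?Y (insert i J) S))) + \<dots> =
      (\<Sum>S\<in>Pow J. ?w J S * (q i * trace (mexp (?Y J S + Z i True)) +
        (1 - q i) * trace (mexp (?Y J S + Z i False))))"
    by (simp only: sum.distrib[symmetric] eqs cong: sum.cong) (simp add: algebra_simps)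
  also have "\<dots> \<le> (\<Sum>S\<in>Pow J. ?w J S * trace (mexp (?Y J S)))"
    by (intro sum_mono mult_left_mono step bernoulli_weight_nonneg q)
      (simp add: transpose_sum sym)
  also have "\<dots> \<le> CARD('d)" by (rule insert.IH)
  finally show ?case .
qed

text \<open>Markov's inequality: on each bad set the trace is at least \<open>exp t\<close>, while
  its mean is at most the dimension.\<close>

lemma bernoulli_matrix_tail:
  fixes Z :: "'n::finite \<Rightarrow> bool \<Rightarrow> real^'d^'d"
  assumes sym: "\<And>i b. transpose (Z i b) = Z i b"
    and q: "\<And>i. 0 \<le> q i" "\<And>i. q i \<le> 1"
    and mean: "\<And>i. psd (mat 1 - (q i *\<^sub>R mexp (Z i True) + (1 - q i) *\<^sub>R mexp (Z i False)))"
    and bad: "\<And>S. S \<in> B \<Longrightarrow> \<exists>x. x \<noteq> 0 \<and> t * (x \<bullet> x) \<le> x \<bullet> ((\<Sum>i\<in>UNIV. Z i (i \<in> S)) *v x)"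
  shows "(\<Sum>S\<in>B. bernoulli_weight q UNIV S) \<le> CARD('d) * exp (- t)"
proof -
  let ?w = "bernoulli_weight q UNIV" and ?Y = "\<lambda>S. \<Sum>i\<in>UNIV. Z i (i \<in> S)"
  have symY: "transpose (?Y S) = ?Y S" for S by (simp add: transpose_sum sym)
  have "(\<Sum>S\<in>B. ?w S) * exp t \<le> (\<Sum>S\<in>B. ?w S * trace (mexp (?Y S)))"
    unfolding sum_distrib_right
  proof (intro sum_mono mult_left_mono bernoulli_weight_nonneg q)
    fix S assume "S \<in> B"
    with bad show "exp t \<le> trace (mexp (?Y S))" using exp_le_trace_mexp[OF symY] by blast
  qed
  also have "\<dots> \<le> (\<Sum>S\<in>Pow UNIV. ?w S * trace (mexp (?Y S)))"
    by (intro sum_mono2 mult_nonneg_nonneg bernoulli_weight_nonneg q psd_trace_nonneg psd_mexp symY) auto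
  also have "\<dots> \<le> CARD('d)"
    by (rule bernoulli_trace_mexp_le[OF sym q mean]) simp
  finally show ?thesis by (simp add: exp_minus field_simps)
qed

section \<open>Exponential moments, from scalars to matrices\<close>

lemma exp_le_quadratic:
  fixes x :: real
  assumes "\<bar>x\<bar> \<le> 1"
  shows "exp x \<le> 1 + x + x\<^sup>2"
proof (cases "0 \<le> x")
  case True
  then show ?thesis using exp_bound[of x] assms by simp
next
  case False
  define y where "y = - x"
  have y: "0 < y" "y \<le> 1" using False assms by (simp_all add: y_def)
  \<comment> \<open>For negative \<open>x\<close> the claim says that
    \<open>(1 - y + y\<^sup>2) * exp y\<close> is at least 1; the quadratic Taylor polynomial of
    \<open>exp y\<close> already suffices.\<close>
  have "(1 - y + y\<^sup>2) * (1 + y + y\<^sup>2 / 2) = 1 + y\<^sup>2 / 2 * (1 + y + y\<^sup>2)"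
    by (simp add: field_simps power2_eq_square)
  then have "1 \<le> (1 - y + y\<^sup>2) * (1 + y + y\<^sup>2 / 2)" using y by simp
  also have "\<dots> \<le> (1 - y + y\<^sup>2) * exp y"
    using y exp_lower_Taylor_quadratic[of y] by (intro mult_left_mono) auto
  finally show ?thesis by (simp add: y_def exp_minus field_simps)
qed

text \<open>The linear terms cancel by centering, and the quadratic ones add up to the variance
  \<open>q * (1 - q)\<close> times \<open>u\<^sup>2\<close>.\<close>

lemma bernoulli_centered_mgf:
  fixes q u :: real
  assumes q: "0 \<le> q" "q \<le> 1" and u: "\<bar>u\<bar> \<le> 1"
  shows "q * exp ((1 - q) * u) + (1 - q) * exp (- q * u) \<le> exp (q * (1 - q) * u\<^sup>2)"
proof -
  have 1: "\<bar>(1 - q) * u\<bar> \<le> 1" and 2: "\<bar>- q * u\<bar> \<le> 1"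
    using q u by (auto simp: abs_mult intro!: mult_le_one)
  have "q * exp ((1 - q) * u) + (1 - q) * exp (- q * u) \<le>
      q * (1 + (1 - q) * u + ((1 - q) * u)\<^sup>2) + (1 - q) * (1 + - q * u + (- q * u)\<^sup>2)"
    using q by (intro add_mono mult_left_mono exp_le_quadratic 1 2) auto
  also have "\<dots> = 1 + q * (1 - q) * u\<^sup>2" by (simp add: algebra_simps power2_eq_square)
  also have "\<dots> \<le> exp (q * (1 - q) * u\<^sup>2)" by (rule exp_ge_add_one_self)
  finally show ?thesis .
qed

lemma bernoulli_scaled_mgf:
  fixes q l \<theta> :: real
  assumes q: "0 \<le> q" "q \<le> 1" and l: "q = 1 \<or> \<bar>\<theta> * l\<bar> \<le> q"
  shows "q * exp (\<theta> * (1 / q - 1) * l - \<theta>\<^sup>2 * ((1 - q) / q) * l\<^sup>2) +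
    (1 - q) * exp (- \<theta> * l - \<theta>\<^sup>2 * ((1 - q) / q) * l\<^sup>2) \<le> 1"
proof (cases "q = 1 \<or> q = 0")
  case True
  \<comment> \<open>At \<open>q = 1\<close> the surviving exponent is 0. At \<open>q = 0\<close> the
    hypothesis forces \<open>\<theta> * l = 0\<close>, and division by zero gives 0.\<close>
  with l show ?thesis by auto
next
  case False
  define u where "u = \<theta> * l / q"
  have "\<bar>u\<bar> \<le> 1" using l q False by (simp add: u_def)
  define E where "E = exp (q * (1 - q) * u\<^sup>2)"
  have "\<theta> * (1 / q - 1) * l = (1 - q) * u" "- \<theta> * l = - q * u"
    "\<theta>\<^sup>2 * ((1 - q) / q) * l\<^sup>2 = q * (1 - q) * u\<^sup>2"
    using False by (simp_all add: u_def field_simps power2_eq_square)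
  then have "?thesis \<longleftrightarrow> (q * exp ((1 - q) * u) + (1 - q) * exp (- q * u)) / E \<le> 1"
    by (simp only: exp_diff E_def add_divide_distrib times_divide_eq_right)
  then show ?thesis
    using bernoulli_centered_mgf[OF q \<open>\<bar>u\<bar> \<le> 1\<close>] by (simp add: E_def)
qed

lemma psd_eigenvalue_le_trace:
  assumes "orthogonal_matrix U" "\<And>i. 0 \<le> f i"
  shows "f i \<le> trace (spec U f)"
  unfolding trace_spec[OF assms(1)] by (rule member_le_sum) (auto simp: assms)

text \<open>
  Subtracting the variance term \<open>\<theta>\<^sup>2 ((1 - q) / q) L\<^sup>2\<close> makes the exponential moment of a single
  summand at most the identity, so that summands can be removed one at a time with Golden--Thompson.
\<close>

definition compensated :: "real \<Rightarrow> real \<Rightarrow> real^'d^'d \<Rightarrow> bool \<Rightarrow> real^'d^'d" where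
  "compensated \<theta> q L b =
    (\<theta> * (of_bool b / q - 1)) *\<^sub>R L - (\<theta>\<^sup>2 * ((1 - q) / q)) *\<^sub>R (L ** L)"

text \<open>Both outcomes are functions of the same \<open>L\<close>, so the claim splits into one
  scalar inequality per eigenvalue, and the trace dominates each eigenvalue.\<close>

lemma psd_compensated_mean:
  fixes L :: "real^'d^'d"
  assumes L: "psd L" and q: "0 \<le> q" "q \<le> 1" and \<theta>: "q = 1 \<or> \<bar>\<theta>\<bar> * trace L \<le> q"
  shows "psd (mat 1 - (q *\<^sub>R mexp (compensated \<theta> q L True) + (1 - q) *\<^sub>R mexp (compensated \<theta> q L False)))"
proof -
  obtain U l where U: "orthogonal_matrix U" "L = spec U l" and l: "\<And>i. 0 \<le> l i"
    using psd_spectral[OF L] by metis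
  have Z: "compensated \<theta> q L b =
      spec U (\<lambda>i. \<theta> * (of_bool b / q - 1) * l i - \<theta>\<^sup>2 * ((1 - q) / q) * (l i)\<^sup>2)" for b
    by (simp add: compensated_def U spec_mult spec_linear power2_eq_square mult.assoc)
  have "q = 1 \<or> \<bar>\<theta> * l i\<bar> \<le> q" for i
  proof -
    have "\<bar>\<theta> * l i\<bar> \<le> \<bar>\<theta>\<bar> * trace L"
      using psd_eigenvalue_le_trace[OF U(1), of l, OF l, of i] l U by (simp add: abs_mult mult_left_mono)
    with \<theta> show ?thesis by auto
  qed
  then have "q * exp (\<theta> * (1 / q - 1) * l i - \<theta>\<^sup>2 * ((1 - q) / q) * (l i)\<^sup>2) +
    (1 - q) * exp (- \<theta> * l i - \<theta>\<^sup>2 * ((1 - q) / q) * (l i)\<^sup>2) \<le> 1" for i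
    using bernoulli_scaled_mgf q by blast
  then show ?thesis
    unfolding Z mexp_spec[OF U(1)] spec_one[OF U(1), symmetric] spec_linear psd_spec_iff[OF U(1)]
    by simp
qed

text \<open>Makes the variance linear in \<open>L\<close>, so that it can be summed against the
  bound on the sum of the \<open>L i\<close>.\<close>

lemma psd_square_le_trace:
  fixes L :: "real^'d^'d"
  assumes L: "psd L"
  shows "x \<bullet> ((L ** L) *v x) \<le> trace L * (x \<bullet> (L *v x))"
proof -
  obtain U l where U: "orthogonal_matrix U" "L = spec U l" and l: "\<And>i. 0 \<le> l i"
    using psd_spectral[OF L] by metis
  have "l i * l i * ((U *v x) $ i)\<^sup>2 \<le> trace L * (l i * ((U *v x) $ i)\<^sup>2)" for i
    using psd_eigenvalue_le_trace[OF U(1), of l, OF l, of i] l U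
    by (simp add: mult.assoc) (intro mult_right_mono mult_nonneg_nonneg; simp)
  then show ?thesis
    by (simp add: U spec_mult inner_spec sum_distrib_left sum_mono)
qed

text \<open>For blocks not kept with certainty, \<open>R\<close> bounds the trace relative to
  \<open>q i\<close>. It serves twice: to keep exponents in the range of the quadratic bound, and to
  bound the total variance. The sign of \<open>\<theta>\<close> selects the tail.\<close>

lemma bernoulli_matrix_concentration:
  fixes L :: "'n::finite \<Rightarrow> real^'d^'d" and q :: "'n \<Rightarrow> real"
  assumes L: "\<And>i. psd (L i)" and sumL: "psd (mat 1 - (\<Sum>i\<in>UNIV. L i))"
    and q: "\<And>i. 0 \<le> q i" "\<And>i. q i \<le> 1"
    and small: "\<And>i. q i = 1 \<or> trace (L i) \<le> q i * R"
    and R: "0 \<le> R" "\<bar>\<theta>\<bar> * R \<le> 1"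
    and bad: "\<And>S. S \<in> B \<Longrightarrow>
      \<exists>x. x \<noteq> 0 \<and> a * (x \<bullet> x) \<le> \<theta> * (x \<bullet> ((\<Sum>i\<in>UNIV. (of_bool (i \<in> S) / q i - 1) *\<^sub>R L i) *v x))"
  shows "(\<Sum>S\<in>B. bernoulli_weight q UNIV S) \<le> CARD('d) * exp (- (a - \<theta>\<^sup>2 * R))"
proof (rule bernoulli_matrix_tail[where Z = "\<lambda>i. compensated \<theta> (q i) (L i)"])
  show "transpose (compensated \<theta> (q i) (L i) b) = compensated \<theta> (q i) (L i) b" for i b
    by (simp add: compensated_def transpose_simps matrix_transpose_mul psd_symmetric L)
  show "psd (mat 1 - (q i *\<^sub>R mexp (compensated \<theta> (q i) (L i) True) +
      (1 - q i) *\<^sub>R mexp (compensated \<theta> (q i) (L i) False)))" for i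
  proof (rule psd_compensated_mean[OF L q])
    show "q i = 1 \<or> \<bar>\<theta>\<bar> * trace (L i) \<le> q i"
    proof (cases "q i = 1")
      case False
      then have "\<bar>\<theta>\<bar> * trace (L i) \<le> \<bar>\<theta>\<bar> * (q i * R)"
        using small[of i] by (intro mult_left_mono) auto
      also have "\<dots> \<le> q i" using mult_left_mono[OF R(2) q(1)[of i]] by (simp add: ac_simps)
      finally show ?thesis by simp
    qed simp
  qed
next
  fix S assume "S \<in> B"
  then obtain x where x: "x \<noteq> 0"
    "a * (x \<bullet> x) \<le> \<theta> * (x \<bullet> ((\<Sum>i\<in>UNIV. (of_bool (i \<in> S) / q i - 1) *\<^sub>R L i) *v x))"
    using bad by blast
  \<comment> \<open>One factor \<open>L i\<close> of the variance is traded for its trace, at most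
    \<open>q i * R\<close>, and this \<open>q i\<close> cancels the denominator.\<close>
  have var: "(1 - q i) / q i * (x \<bullet> ((L i ** L i) *v x)) \<le> R * (x \<bullet> (L i *v x))" for i
  proof (cases "q i = 1 \<or> q i = 0")
    case True
    then show ?thesis using L[of i] R(1) by (auto simp: psd_def)
  next
    case False
    have "(1 - q i) / q i * (x \<bullet> ((L i ** L i) *v x)) \<le> (1 - q i) / q i * (trace (L i) * (x \<bullet> (L i *v x)))"
      using q by (intro mult_left_mono psd_square_le_trace L) auto
    also have "\<dots> \<le> (1 - q i) / q i * (q i * R * (x \<bullet> (L i *v x)))"
      using q small[of i] L[of i] False by (intro mult_left_mono mult_right_mono) (auto simp: psd_def)
    also have "\<dots> = (1 - q i) * (R * (x \<bullet> (L i *v x)))" using False by simp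
    also have "\<dots> \<le> R * (x \<bullet> (L i *v x))"
      using q[of i] R(1) L[of i] by (intro mult_left_le_one_le) (auto simp: psd_def)
    finally show ?thesis .
  qed
  have "(\<Sum>i\<in>UNIV. (1 - q i) / q i * (x \<bullet> ((L i ** L i) *v x))) \<le> (\<Sum>i\<in>UNIV. R * (x \<bullet> (L i *v x)))"
    by (intro sum_mono var)
  also have "\<dots> = R * (x \<bullet> ((\<Sum>i\<in>UNIV. L i) *v x))"
    by (simp add: sum_matrix_vector_mult inner_sum_right sum_distrib_left)
  also have "\<dots> \<le> R * (x \<bullet> x)"
    using sumL R(1) by (intro mult_left_mono) (simp_all add: psd_def matrix_vector_mult_diff_rdistrib inner_diff_right)
  finally have "\<theta>\<^sup>2 * (\<Sum>i\<in>UNIV. (1 - q i) / q i * (x \<bullet> ((L i ** L i) *v x))) \<le> \<theta>\<^sup>2 * (R * (x \<bullet> x))"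
    by (intro mult_left_mono) simp_all
  moreover have "x \<bullet> ((\<Sum>i\<in>UNIV. compensated \<theta> (q i) (L i) (i \<in> S)) *v x) =
      \<theta> * (x \<bullet> ((\<Sum>i\<in>UNIV. (of_bool (i \<in> S) / q i - 1) *\<^sub>R L i) *v x)) -
      \<theta>\<^sup>2 * (\<Sum>i\<in>UNIV. (1 - q i) / q i * (x \<bullet> ((L i ** L i) *v x)))"
    by (simp add: compensated_def sum_matrix_vector_mult inner_sum_right sum_distrib_left
        matrix_vector_mult_diff_rdistrib scaleR_matrix_vector_mult inner_diff_right sum_subtractf mult.assoc)
  ultimately have "(a - \<theta>\<^sup>2 * R) * (x \<bullet> x) \<le>
      x \<bullet> ((\<Sum>i\<in>UNIV. compensated \<theta> (q i) (L i) (i \<in> S)) *v x)"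
    using x(2) by (simp add: algebra_simps)
  with x(1) show "\<exists>x. x \<noteq> 0 \<and> (a - \<theta>\<^sup>2 * R) * (x \<bullet> x) \<le>
      x \<bullet> ((\<Sum>i\<in>UNIV. compensated \<theta> (q i) (L i) (i \<in> S)) *v x)" by blast
qed (rule q)+

subsection \<open>Leverage scores and Loewner bounds\<close>

lemma gram_eq_sum_blocks:
  fixes A :: "real^'d^('n::finite \<times> 'k::finite)"
  shows "transpose A ** A = (\<Sum>i\<in>UNIV. transpose (block A i) ** block A i)"
  by (simp add: vec_eq_iff gram_nth block_def sum.cartesian_product case_prod_beta
      UNIV_Times_UNIV[symmetric] del: UNIV_Times_UNIV)

lemma gram_vstack:
  "transpose (vstack A B) ** vstack A B = transpose A ** A + transpose B ** B"
  by (simp add: vec_eq_iff gram_nth vstack_def sum.Plus UNIV_Plus_UNIV[symmetric] del: UNIV_Plus_UNIV)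

lemma psd_sum: "(\<And>i. i \<in> I \<Longrightarrow> psd (F i)) \<Longrightarrow> psd (sum F I)"
  by (simp add: psd_def transpose_sum sum_matrix_vector_mult inner_sum_right sum_nonneg)

lemma psd_add: "psd M \<Longrightarrow> psd N \<Longrightarrow> psd (M + N)"
  by (simp add: psd_def transpose_simps matrix_vector_mult_add_rdistrib inner_add_right)

lemma psd_cauchy_schwarz:
  assumes "psd N"
  shows "\<bar>x \<bullet> (N *v y)\<bar> \<le> sqrt (x \<bullet> (N *v x)) * sqrt (y \<bullet> (N *v y))"
proof -
  define S where "S = psd_sqrt N"
  have S: "transpose S = S" "N = S ** S"
    using psd_sqrt[OF assms] by (simp_all add: S_def psd_symmetric)
  have "x \<bullet> (N *v y) = (S *v x) \<bullet> (S *v y)" for x y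
    using inner_matrix_vector_transpose[of x S "S *v y"] by (simp add: S matrix_vector_mul_assoc)
  then show ?thesis
    using Cauchy_Schwarz_ineq2[of "S *v x" "S *v y"] by (simp add: norm_eq_sqrt_inner)
qed

text \<open>\<open>D\<close> itself may be indefinite, but \<open>P\<close> and \<open>N\<close> are
  positive semidefinite with \<open>P - N = 2 D\<close> and \<open>P + N = 2 \<epsilon> H\<close>.
  Cauchy--Schwarz is applied to each form, and once more in the plane to recombine the two.\<close>

lemma loewner_bilinear_bound:
  assumes "0 \<le> \<epsilon>" and lower: "(- \<epsilon>) *\<^sub>R H \<preceq>\<^sub>L D" and upper: "D \<preceq>\<^sub>L \<epsilon> *\<^sub>R H"
  shows "\<bar>x \<bullet> (D *v y)\<bar> \<le> \<epsilon> * sqrt (x \<bullet> (H *v x)) * sqrt (y \<bullet> (H *v y))"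
proof -
  define P N where "P = D + \<epsilon> *\<^sub>R H" and "N = \<epsilon> *\<^sub>R H - D"
  have psd: "psd P" "psd N" using lower upper by (simp_all add: loewner_le_def P_def N_def)
  let ?p = "\<lambda>x. x \<bullet> (P *v x)" and ?n = "\<lambda>x. x \<bullet> (N *v x)"
  have sum: "?p x + ?n x = 2 * \<epsilon> * (x \<bullet> (H *v x))" for x
    by (simp add: P_def N_def algebra_simps scaleR_matrix_vector_mult inner_add_right inner_diff_right)
  have "2 * \<bar>x \<bullet> (D *v y)\<bar> = \<bar>x \<bullet> (P *v y) - x \<bullet> (N *v y)\<bar>"
    by (simp add: P_def N_def algebra_simps inner_add_right inner_diff_right)
  also have "\<dots> \<le> sqrt (?p x) * sqrt (?p y) + sqrt (?n x) * sqrt (?n y)"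
    using psd_cauchy_schwarz[OF psd(1), of x y] psd_cauchy_schwarz[OF psd(2), of x y] by linarith
  also have "\<dots> = (sqrt (?p x), sqrt (?n x)) \<bullet> (sqrt (?p y), sqrt (?n y))"
    by simp
  also have "\<dots> \<le> norm (sqrt (?p x), sqrt (?n x)) * norm (sqrt (?p y), sqrt (?n y))"
    by (rule norm_cauchy_schwarz)
  also have "\<dots> = sqrt (2 * \<epsilon> * (x \<bullet> (H *v x))) * sqrt (2 * \<epsilon> * (y \<bullet> (H *v y)))"
    using psd by (simp add: norm_Pair psd_def sum[symmetric])
  also have "\<dots> = 2 * (\<epsilon> * sqrt (x \<bullet> (H *v x)) * sqrt (y \<bullet> (H *v y)))"
    using assms(1) by (simp add: real_sqrt_mult ac_simps)
  finally show ?thesis by simp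
qed

text \<open>\<open>R\<close> is the square root of the pseudoinverse of the Gram matrix, so a
  leverage score is the squared length of a whitened row.\<close>

lemma leverage_score_spec:
  assumes U: "orthogonal_matrix U" and B: "transpose B ** B = spec U f" and f: "\<And>i. 0 \<le> f i"
  defines "R \<equiv> spec U (\<lambda>i. 1 / sqrt (f i))"
  shows "leverage_score B j = (R *v row j B) \<bullet> (R *v row j B)"
proof -
  have "pinv (transpose B ** B) = R ** R"
    using f by (simp add: B R_def pinv_spec[OF U] spec_mult[OF U])
  moreover have "transpose R = R" by (simp add: R_def)
  ultimately show ?thesis
    using inner_matrix_vector_transpose[of "row j B" R "R *v row j B"]
    by (simp only: leverage_score_def matrix_vector_mul_assoc)
qed

lemma trace_whitened_gram:
  fixes B :: "real^'d^'r" and R :: "real^'d^'d"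
  assumes "transpose R = R"
  shows "trace (R ** (transpose B ** B) ** R) = (\<Sum>j\<in>UNIV. (R *v row j B) \<bullet> (R *v row j B))"
proof -
  have "(B ** R) $ j = R *v row j B" for j
  proof -
    have "(B ** R) $ j = transpose R *v row j B"
      by (simp add: vec_eq_iff matrix_matrix_mult_def matrix_vector_mult_def transpose_def row_def mult.commute
          del: transpose_matrix_vector)
    then show ?thesis by (simp only: assms)
  qed
  moreover have "R ** (transpose B ** B) ** R = transpose (B ** R) ** (B ** R)"
    by (simp add: matrix_transpose_mul assms matrix_mul_assoc)
  ultimately show ?thesis by (simp add: trace_transpose_mult inner_vec_def[of "B ** R"])
qed

text \<open>Whitening must be reversible although \<open>G + G'\<close> may be singular:
  \<open>R\<close> inverts \<open>C\<close> only off the kernel, so \<open>G\<close> must have no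
  part there.\<close>

lemma spec_conjugation_cancel:
  fixes G :: "real^'d^'d"
  assumes U: "orthogonal_matrix U" and f: "\<And>i. 0 \<le> f i"
    and G: "psd G" and G': "psd G'" and H: "spec U f = G + G'"
  defines "R \<equiv> spec U (\<lambda>i. 1 / sqrt (f i))" and "C \<equiv> spec U (\<lambda>i. sqrt (f i))"
  shows "C ** (R ** G ** R) ** C = G"
proof -
  \<comment> \<open>\<open>N\<close> projects onto the kernel of \<open>G + G'\<close>, where the form \<open>G\<close> must vanish.\<close>
  define N where "N = spec U (\<lambda>i. if f i = 0 then 1 else 0)"
  have N: "transpose N = N" by (simp add: N_def)
  have "N ** spec U f ** N = spec U (\<lambda>_. 0)"
    unfolding N_def spec_mult[OF U] by (rule arg_cong[where f = "spec U"]) auto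
  also have "\<dots> = 0" by (simp add: vec_eq_iff spec_nth)
  finally have "N ** G ** N + N ** G' ** N = 0"
    by (simp add: H matrix_mult_simps)
  then have "trace (N ** G ** N + N ** G' ** N) = trace (0 :: real^'d^'d)" by (rule arg_cong)
  then have "trace (N ** G ** N) + trace (N ** G' ** N) = 0"
    by (simp only: trace_add) (simp add: trace_def)
  moreover have psd: "psd (N ** G ** N)" "psd (N ** G' ** N)"
    using psd_congruence[OF G, of N] psd_congruence[OF G', of N] by (simp_all add: N)
  ultimately have "N ** G ** N = 0"
    using psd_trace_nonneg[OF psd(1)] psd_trace_nonneg[OF psd(2)] by (intro psd_trace_eq_0) auto
  \<comment> \<open>The root turns \<open>N ** G ** N\<close> into the Gram matrix of
    \<open>S ** N\<close>, so a vanishing form on the kernel becomes a vanishing product.\<close>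
  moreover define S where "S = psd_sqrt G"
  have S: "transpose S = S" "G = S ** S"
    using psd_sqrt[OF G] by (simp_all add: S_def psd_symmetric)
  ultimately have "transpose (S ** N) ** (S ** N) = 0"
    by (simp add: matrix_transpose_mul N matrix_mul_assoc)
  then have "S ** N = 0"
    using trace_transpose_mult[of "S ** N" "S ** N"] by (simp add: trace_def)
  then have "transpose (S ** N) = 0" by (simp add: transpose_simps)
  then have "N ** S = 0" by (simp only: matrix_transpose_mul N S)
  have CR: "C ** R = mat 1 - N" "R ** C = mat 1 - N"
    unfolding C_def R_def N_def spec_mult[OF U] spec_one[OF U, symmetric] spec_linear
    by (rule arg_cong[where f = "spec U"], auto)+
  have "C ** (R ** G ** R) ** C = (C ** R) ** S ** (S ** (R ** C))"
    by (simp add: S matrix_mul_assoc)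
  also have "\<dots> = G"
    by (simp add: CR matrix_mult_simps \<open>N ** S = 0\<close> \<open>S ** N = 0\<close>) (simp add: S)
  finally show ?thesis .
qed

text \<open>\<open>C\<close> is the square root of \<open>H = transpose A ** A + Q\<close> and
  \<open>R\<close> that of its pseudoinverse. \<open>R ** H ** R\<close> is a projection, and
  subtracting the part due to \<open>Q\<close> leaves the whitened blocks with sum at most the
  identity.\<close>

lemma whitening:
  fixes A :: "real^'d^('n::finite \<times> 'k::finite)" and Q :: "real^'d^'d"
  assumes Q: "psd Q"
  defines "G \<equiv> \<lambda>i. transpose (block A i) ** block A i"
  obtains C R where "transpose C = C" "transpose R = R" "C ** C = transpose A ** A + Q"
    "\<And>i. C ** (R ** G i ** R) ** C = G i" "psd (mat 1 - (\<Sum>i\<in>UNIV. R ** G i ** R))"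
    "\<And>i. trace (R ** G i ** R) = block_partial_leverage_score Q A i"
proof -
  let ?H = "transpose A ** A + Q"
  have psdG: "psd (G i)" for i unfolding G_def by (rule psd_gram)
  have AA: "transpose A ** A = sum G UNIV" by (simp add: G_def gram_eq_sum_blocks)
  obtain U f where U: "orthogonal_matrix U" "?H = spec U f" and f: "\<And>i. 0 \<le> f i"
    using psd_spectral[OF psd_add[OF psd_gram Q]] by metis
  define C R where "C = spec U (\<lambda>i. sqrt (f i))" and "R = spec U (\<lambda>i. 1 / sqrt (f i))"
  have sym: "transpose C = C" "transpose R = R" by (simp_all add: C_def R_def)
  have 1: "C ** C = ?H" using f by (simp add: C_def U(2) spec_mult[OF U(1)])
  have 2: "C ** (R ** G i ** R) ** C = G i" for i
    unfolding C_def R_def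
  proof (rule spec_conjugation_cancel[OF U(1) f psdG])
    \<comment> \<open>The other blocks together with \<open>Q\<close> play the part of
      \<open>G'\<close>.\<close>
    show "psd (sum G (UNIV - {i}) + Q)" by (intro psd_add psd_sum psdG Q)
    show "spec U f = G i + (sum G (UNIV - {i}) + Q)"
      by (simp add: U(2)[symmetric] AA sum.remove[of UNIV i])
  qed
  have "(\<Sum>i\<in>UNIV. R ** G i ** R) = R ** (transpose A ** A) ** R"
    by (simp add: AA matrix_mult_sum_simps)
  also have "\<dots> = R ** ?H ** R - R ** Q ** R" by (simp add: matrix_mult_simps)
  finally have "mat 1 - (\<Sum>i\<in>UNIV. R ** G i ** R) = (mat 1 - R ** ?H ** R) + R ** Q ** R" by simp
  moreover have "mat 1 - R ** ?H ** R = spec U (\<lambda>i. 1 - 1 / sqrt (f i) * f i * (1 / sqrt (f i)))"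
    by (simp only: R_def U(2) spec_mult[OF U(1)] spec_one[OF U(1), symmetric] spec_linear)
  \<comment> \<open>The value is 0 where \<open>f i > 0\<close> and 1 where
    \<open>f i = 0\<close>.\<close>
  moreover have "1 - 1 / sqrt (f i) * f i * (1 / sqrt (f i)) \<ge> 0" for i
    using f[of i] by simp
  then have "psd (spec U (\<lambda>i. 1 - 1 / sqrt (f i) * f i * (1 / sqrt (f i))))"
    by (simp only: psd_spec_iff[OF U(1)] simp_thms)
  moreover have "psd (R ** Q ** R)" using psd_congruence[OF Q, of R] by (simp add: sym)
  ultimately have 3: "psd (mat 1 - (\<Sum>i\<in>UNIV. R ** G i ** R))" by (simp only: psd_add)
  have gram: "transpose (vstack A (psd_sqrt Q)) ** vstack A (psd_sqrt Q) = spec U f"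
    using psd_sqrt[OF Q] by (simp add: gram_vstack psd_symmetric U(2))
  have 4: "trace (R ** G i ** R) = block_partial_leverage_score Q A i" for i
  proof -
    have "row (Inl (i, j)) (vstack A (psd_sqrt Q)) = row j (block A i)" for j
      by (simp add: row_def vstack_def block_def)
    then show ?thesis
      by (simp only: G_def trace_whitened_gram[OF sym(2)] block_partial_leverage_score_def
          leverage_score_spec[OF U(1) gram f, folded R_def])
  qed
  show ?thesis by (rule that[OF sym 1 2 3 4])
qed

section \<open>Two-sided spectral tail and return to the Loewner order\<close>

lemma bernoulli_weight_two_sided_tail:
  fixes L :: "'n::finite \<Rightarrow> real^'d^'d" and q :: "'n \<Rightarrow> real"
  assumes L: "\<And>i. psd (L i)" "psd (mat 1 - (\<Sum>i\<in>UNIV. L i))"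
    and q: "\<And>i. 0 \<le> q i" "\<And>i. q i \<le> 1"
    and l: "0 < l" and \<epsilon>: "0 < \<epsilon>" "\<epsilon> \<le> 2"
    and small: "\<And>i. q i = 1 \<or> trace (L i) \<le> q i * (\<epsilon>\<^sup>2 / (4 * l))"
  defines "T \<equiv> \<lambda>S. \<Sum>i\<in>UNIV. (of_bool (i \<in> S) / q i - 1) *\<^sub>R L i"
  shows "(\<Sum>S | \<exists>x. \<epsilon> * (x \<bullet> x) < \<bar>x \<bullet> (T S *v x)\<bar>. bernoulli_weight q UNIV S) \<le> 2 * CARD('d) * exp (- l)"
proof -
  \<comment> \<open>This maximises \<open>\<theta> * \<epsilon> - \<theta>\<^sup>2 * R\<close> for
    \<open>R = \<epsilon>\<^sup>2 / (4 * l)\<close>, with value \<open>l\<close>. Then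
    \<open>\<theta> * R = \<epsilon> / 2\<close>, so \<open>\<epsilon> \<le> 2\<close> gives the
    range condition.\<close>
  define \<theta> where "\<theta> = 2 * l / \<epsilon>"
  define B where "B \<sigma> = {S. \<exists>x. x \<noteq> 0 \<and> \<theta> * \<epsilon> * (x \<bullet> x) \<le> \<sigma> * \<theta> * (x \<bullet> (T S *v x))}" for \<sigma> :: real
  have tail: "(\<Sum>S\<in>B \<sigma>. bernoulli_weight q UNIV S) \<le> CARD('d) * exp (- l)" if \<sigma>: "\<sigma> = 1 \<or> \<sigma> = -1" for \<sigma>
  proof -
    have "(\<Sum>S\<in>B \<sigma>. bernoulli_weight q UNIV S) \<le>
        CARD('d) * exp (- (\<theta> * \<epsilon> - (\<sigma> * \<theta>)\<^sup>2 * (\<epsilon>\<^sup>2 / (4 * l))))"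
    proof (rule bernoulli_matrix_concentration[OF L q small])
      show "\<bar>\<sigma> * \<theta>\<bar> * (\<epsilon>\<^sup>2 / (4 * l)) \<le> 1"
        using \<sigma> l \<epsilon> by (auto simp: \<theta>_def abs_mult power2_eq_square field_simps)
    qed (use l in \<open>auto simp: B_def T_def\<close>)
    also have "\<theta> * \<epsilon> - (\<sigma> * \<theta>)\<^sup>2 * (\<epsilon>\<^sup>2 / (4 * l)) = l"
      using \<sigma> l \<epsilon> by (auto simp: \<theta>_def power2_eq_square field_simps)
    finally show ?thesis .
  qed
  have "{S. \<exists>x. \<epsilon> * (x \<bullet> x) < \<bar>x \<bullet> (T S *v x)\<bar>} \<subseteq> B 1 \<union> B (-1)"
  proof
    fix S assume "S \<in> {S. \<exists>x. \<epsilon> * (x \<bullet> x) < \<bar>x \<bullet> (T S *v x)\<bar>}"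
    then obtain x where x: "\<epsilon> * (x \<bullet> x) < \<bar>x \<bullet> (T S *v x)\<bar>" by blast
    then have "x \<noteq> 0" by auto
    have "0 < \<theta>" using l \<epsilon> by (simp add: \<theta>_def)
    then have "\<theta> * (\<epsilon> * (x \<bullet> x)) \<le> \<theta> * \<bar>x \<bullet> (T S *v x)\<bar>"
      using x by (intro mult_left_mono) auto
    with \<open>x \<noteq> 0\<close> show "S \<in> B 1 \<union> B (-1)"
      unfolding B_def by (cases "x \<bullet> (T S *v x) \<ge> 0") (auto simp: mult.assoc intro!: exI[of _ x])
  qed
  then have "(\<Sum>S | \<exists>x. \<epsilon> * (x \<bullet> x) < \<bar>x \<bullet> (T S *v x)\<bar>. bernoulli_weight q UNIV S) \<le>
      (\<Sum>S\<in>B 1 \<union> B (-1). bernoulli_weight q UNIV S)"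
    by (intro sum_mono2 bernoulli_weight_nonneg q) auto
  also have "\<dots> \<le> (\<Sum>S\<in>B 1. bernoulli_weight q UNIV S) + (\<Sum>S\<in>B (-1). bernoulli_weight q UNIV S)"
    by (subst sum.union_inter[symmetric]) (auto intro!: sum_nonneg bernoulli_weight_nonneg q)
  also have "\<dots> \<le> 2 * CARD('d) * exp (- l)"
    using tail[of 1] tail[of "-1"] by simp
  finally show ?thesis .
qed

text \<open>Undoes the whitening: congruence by \<open>C\<close> preserves the order and takes the
  identity to \<open>C ** C\<close>.\<close>

lemma loewner_bounds_congruence:
  fixes C T :: "real^'d^'d"
  assumes C: "transpose C = C" and T: "transpose T = T"
    and bound: "\<And>x. \<bar>x \<bullet> (T *v x)\<bar> \<le> \<epsilon> * (x \<bullet> x)"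
  shows "(- \<epsilon>) *\<^sub>R (C ** C) \<preceq>\<^sub>L C ** T ** C" "C ** T ** C \<preceq>\<^sub>L \<epsilon> *\<^sub>R (C ** C)"
proof -
  have "0 \<le> x \<bullet> (T *v x) + \<epsilon> * (x \<bullet> x)" "0 \<le> \<epsilon> * (x \<bullet> x) - x \<bullet> (T *v x)" for x
    using bound[of x] by linarith+
  then have "psd (T + \<epsilon> *\<^sub>R mat 1)" "psd (\<epsilon> *\<^sub>R mat 1 - T)"
    by (simp_all add: psd_def T transpose_simps matrix_vector_mult_add_rdistrib
        matrix_vector_mult_diff_rdistrib scaleR_matrix_vector_mult inner_add_right inner_diff_right)
  from psd_congruence[OF this(1), of C] psd_congruence[OF this(2), of C]
  show "(- \<epsilon>) *\<^sub>R (C ** C) \<preceq>\<^sub>L C ** T ** C" "C ** T ** C \<preceq>\<^sub>L \<epsilon> *\<^sub>R (C ** C)"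
    by (simp_all add: loewner_le_def C matrix_mult_simps)
qed

theorem theorem9:
  fixes A :: "real^'d^('n::finite \<times> 'k::finite)"
    and Q :: "real^'d^'d"
    and \<tau>h p q :: "'n \<Rightarrow> real"
    and \<epsilon> \<delta> s :: real
    and M :: "'w measure"
    and \<xi> :: "'n \<Rightarrow> 'w \<Rightarrow> bool"
    and H :: "real^'d^'d"
    and Ht :: "'w \<Rightarrow> real^'d^'d"
  assumes Q: "psd Q"
    and \<epsilon>: "0 < \<epsilon>" "\<epsilon> < 1"
    and \<delta>: "0 < \<delta>" "\<delta> < 1"
    and over: "\<And>i. \<tau>h i \<ge> block_partial_leverage_score Q A i"
    and p: "\<And>i. p i = \<tau>h i / (\<Sum>j\<in>UNIV. \<tau>h j)"
    and q: "\<And>i. q i = min (s * p i) 1"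
    and M: "prob_space M"
    and indep: "prob_space.indep_vars M (\<lambda>_. count_space UNIV) \<xi> UNIV"
    and bernoulli: "\<And>i. measure M {\<omega> \<in> space M. \<xi> i \<omega>} = q i"
    and s: "s \<ge> 4 * (\<Sum>i\<in>UNIV. \<tau>h i) * ln (4 * real CARD('d) / \<delta>) * (1 / \<epsilon>\<^sup>2)"
    and H: "H = transpose A ** A + Q"
    and Ht: "\<And>\<omega>. Ht \<omega> =
      transpose A ** transpose (sampling_matrix q (\<lambda>i. \<xi> i \<omega>))
        ** sampling_matrix q (\<lambda>i. \<xi> i \<omega>) ** A + Q"
  shows "measure M {\<omega> \<in> space M.
      (- \<epsilon>) *\<^sub>R H \<preceq>\<^sub>L Ht \<omega> - H \<and> Ht \<omega> - H \<preceq>\<^sub>L \<epsilon> *\<^sub>R H \<and>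
      (\<forall>K. cone K \<longrightarrow> (\<forall>x\<in>K. \<forall>y\<in>K.
        \<bar>x \<bullet> ((Ht \<omega> - H) *v y)\<bar> \<le> \<epsilon> * sqrt (x \<bullet> (H *v x)) * sqrt (y \<bullet> (H *v y))))}
    \<ge> 1 - \<delta>"
proof -
  interpret prob_space M by (rule M)
  define G where "G i = transpose (block A i) ** block A i" for i
  obtain C R where C: "transpose C = C" and R: "transpose R = R" and CC: "C ** C = H"
    and CRG: "\<And>i. C ** (R ** G i ** R) ** C = G i"
    and sumL: "psd (mat 1 - (\<Sum>i\<in>UNIV. R ** G i ** R))"
    and tau: "\<And>i. trace (R ** G i ** R) = block_partial_leverage_score Q A i"
    by (rule whitening[OF Q, of A, folded G_def H]) (rule that)
  define L where "L i = R ** G i ** R" for i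
  have L: "psd (L i)" for i
    using psd_congruence[OF psd_gram[of "block A i"], of R] by (simp add: L_def G_def R)
  define l where "l = ln (4 * real CARD('d) / \<delta>)"
  have "1 \<le> real CARD('d)" by (simp add: Suc_leI)
  then have "\<delta> < real CARD('d)" using \<delta>(2) by linarith
  then have l: "0 < l" using \<delta> by (simp add: l_def)
  define \<tau> where "\<tau> = (\<Sum>i\<in>UNIV. \<tau>h i)"
  have traceL: "0 \<le> trace (L i)" "trace (L i) \<le> \<tau>h i" for i
    using psd_trace_nonneg[OF L] over tau by (simp_all add: L_def)
  have \<tau>h: "0 \<le> \<tau>h i" for i using traceL[of i] by linarith
  then have \<tau>: "0 \<le> \<tau>" "\<tau>h i \<le> \<tau>" for i
    unfolding \<tau>_def by (auto intro: member_le_sum sum_nonneg)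
  have s': "4 * l * \<tau> / \<epsilon>\<^sup>2 \<le> s" using s by (simp add: l_def \<tau>_def ac_simps)
  then have "0 \<le> s" using l \<tau>(1) by (elim order_trans[rotated]) simp
  then have q01: "0 \<le> q i" "q i \<le> 1" for i using \<tau>h \<tau>(1) by (simp_all add: q p \<tau>_def[symmetric])
  have small: "q i = 1 \<or> trace (L i) \<le> q i * (\<epsilon>\<^sup>2 / (4 * l))" for i
  proof (cases "q i = 1 \<or> \<tau> = 0")
    \<comment> \<open>If \<open>\<tau> = 0\<close>, every overestimate is 0, and so is the trace it
      dominates.\<close>
    case True
    moreover have "0 \<le> q i * (\<epsilon>\<^sup>2 / (4 * l))" using q01(1)[of i] l by simp
    ultimately show ?thesis using traceL[of i] \<tau>(2)[of i] by linarith
  next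
    case False
    then have "\<tau> > 0" and qi: "q i = s * \<tau>h i / \<tau>" using \<tau>(1) by (auto simp: q p \<tau>_def min_def split: if_splits)
    \<comment> \<open>Below the cap, \<open>q i\<close> is \<open>s * \<tau>h i / \<tau>\<close>,
      and the lower bound on \<open>s\<close> is exactly what makes \<open>\<tau>h i\<close> at most
      \<open>q i * (\<epsilon>\<^sup>2 / (4 * l))\<close>.\<close>
    have "\<tau>h i = 4 * l * \<tau> / \<epsilon>\<^sup>2 * (\<tau>h i / \<tau> * (\<epsilon>\<^sup>2 / (4 * l)))"
      using \<open>\<tau> > 0\<close> l \<epsilon> by simp
    also have "\<dots> \<le> s * (\<tau>h i / \<tau> * (\<epsilon>\<^sup>2 / (4 * l)))"
      using s' \<tau>h[of i] \<tau>(1) l by (intro mult_right_mono) auto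
    also have "\<dots> = q i * (\<epsilon>\<^sup>2 / (4 * l))" by (simp add: qi)
    finally show ?thesis using traceL[of i] by linarith
  qed
  define T where "T S = (\<Sum>i\<in>UNIV. (of_bool (i \<in> S) / q i - 1) *\<^sub>R L i)" for S
  have Ht_H: "Ht \<omega> - H = C ** T {i. \<xi> i \<omega>} ** C" for \<omega>
  proof -
    have "Ht \<omega> - H = (\<Sum>i\<in>UNIV. (of_bool (\<xi> i \<omega>) / q i) *\<^sub>R G i) - (\<Sum>i\<in>UNIV. G i)"
      unfolding Ht H sampling_matrix_gram[OF q01(1)] G_def gram_eq_sum_blocks[of A] by simp
    also have "\<dots> = (\<Sum>i\<in>UNIV. (of_bool (\<xi> i \<omega>) / q i - 1) *\<^sub>R (C ** L i ** C))"
      by (simp add: sum_subtractf[symmetric] L_def CRG scaleR_diff_left)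
    finally show ?thesis by (simp add: T_def matrix_mult_sum_simps matrix_mult_simps)
  qed
  \<comment> \<open>As a predicate on the sampled set alone, the event falls under
    \<open>prob_bernoulli_family\<close>.\<close>
  define good where "good S \<longleftrightarrow> (- \<epsilon>) *\<^sub>R H \<preceq>\<^sub>L C ** T S ** C \<and> C ** T S ** C \<preceq>\<^sub>L \<epsilon> *\<^sub>R H \<and>
      (\<forall>K. cone K \<longrightarrow> (\<forall>x\<in>K. \<forall>y\<in>K.
        \<bar>x \<bullet> ((C ** T S ** C) *v y)\<bar> \<le> \<epsilon> * sqrt (x \<bullet> (H *v x)) * sqrt (y \<bullet> (H *v y))))" for S
  have good: "good S" if "\<And>x. \<bar>x \<bullet> (T S *v x)\<bar> \<le> \<epsilon> * (x \<bullet> x)" for S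
  proof -
    have "transpose (T S) = T S"
      by (simp add: T_def transpose_sum transpose_simps psd_symmetric[OF L])
    note bounds = loewner_bounds_congruence[OF C this that, unfolded CC]
    show ?thesis
      unfolding good_def using bounds loewner_bilinear_bound[OF less_imp_le[OF \<epsilon>(1)] bounds] by blast
  qed
  let ?w = "bernoulli_weight q UNIV"
  have total: "(\<Sum>S\<in>UNIV. ?w S) = 1"
    using prob_bernoulli_family[OF indep bernoulli, of "\<lambda>_. True"] by (simp add: prob_space)
  have "(\<Sum>S | \<not> good S. ?w S) \<le> (\<Sum>S | \<exists>x. \<epsilon> * (x \<bullet> x) < \<bar>x \<bullet> (T S *v x)\<bar>. ?w S)"
    by (intro sum_mono2 bernoulli_weight_nonneg q01) (use good in \<open>auto simp: not_less[symmetric]\<close>)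
  also have "\<dots> \<le> 2 * CARD('d) * exp (- l)"
    unfolding T_def using \<epsilon>
    by (intro bernoulli_weight_two_sided_tail[OF L sumL[folded L_def] q01 l] small) auto
  \<comment> \<open>By the choice of \<open>l\<close> the left side equals
    \<open>\<delta> / 2\<close>.\<close>
  also have "\<dots> \<le> \<delta>"
    using \<delta> by (simp add: l_def exp_minus)
  finally have "1 - \<delta> \<le> (\<Sum>S\<in>UNIV. ?w S) - (\<Sum>S | \<not> good S. ?w S)"
    by (simp add: total)
  also have "\<dots> = (\<Sum>S | good S. ?w S)"
    by (subst sum_diff[symmetric]) (auto intro!: sum.cong)
  also have "\<dots> = prob {\<omega> \<in> space M. good {i. \<xi> i \<omega>}}"
    by (rule prob_bernoulli_family[OF indep bernoulli, symmetric])
  finally show ?thesis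
    unfolding good_def Ht_H .
qed

end
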